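(* Let $R$ be a commutative ring with unit, let $\mathcal{A}$ be any Poisson algebra over $R$, $I$ a Poisson ideal of $\mathcal{A}$, and $(U(\mathcal{A}),\alpha_{\mathcal{A}},\beta_{\mathcal{A}})$ a Poisson enveloping algebra of $\mathcal{A}$. Let $\mathcal{B}=\mathcal{A}/I$ be the quotient Poisson algebra, with canonical surjection $\pi:\mathcal{A}\to\mathcal{B}$. Let $I_{\mathcal{B}}$ be the two-sided ideal of the algebra $\mathcal{B}\otimes_{\mathcal{A}}U(\mathcal{A})$ generated by $1_{\mathcal{B}}\otimes\beta_{\mathcal{A}}(I)$, let $\pi_{\mathcal{B}}:\mathcal{B}\otimes_{\mathcal{A}}U(\mathcal{A})\to(\mathcal{B}\otimes_{\mathcal{A}}U(\mathcal{A}))/I_{\mathcal{B}}$ be the canonical surjection, and define $$\alpha,\beta:\mathcal{B}\to(\mathcal{B}\otimes_{\mathcal{A}}U(\mathcal{A}))/I_{\mathcal{B}},\qquad\alpha(\pi(a)):=\pi_{\mathcal{B}}(1_{\mathcal{B}}\otimes\alpha_{\mathcal{A}}(a)),\quad\beta(\pi(a)):=\pi_{\mathcal{B}}(1_{\mathcal{B}}\otimes\beta_{\mathcal{A}}(a))\qquad(a\in\mathcal{A}).$$ Then a Poisson enveloping algebra of the quotient Poisson algebra $\mathcal{B}=\mathcal{A}/I$ is $((\mathcal{B}\otimes_{\mathcal{A}}U(\mathcal{A}))/I_{\mathcal{B}},\alpha,\beta)$.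
   Context: All rings and associative algebras are unitary and morphisms preserve units; algebras are over $R$. A Poisson algebra over $R$ is an $R$-module $\mathcal{A}$ with a commutative (associative, unitary) $R$-algebra structure and an $R$-Lie algebra structure $\{\cdot,\cdot\}$ such that $\{a_1a_2,a_3\}=a_1\{a_2,a_3\}+a_2\{a_1,a_3\}$ for all $a_1,a_2,a_3$. A Poisson ideal $I$ of $\mathcal{A}$ is a submodule which is both an ideal and a Lie ideal; $\mathcal{A}/I$ carries the unique Poisson structure making the canonical surjection a morphism of algebras and of Lie algebras. For an algebra $U$, $U_L$ denotes $U$ viewed as a Lie algebra with the commutator bracket. A Poisson enveloping algebra of a Poisson algebra $\mathcal{A}$ is a triple $(U,\alpha,\beta)$ with $U$ an algebra, $\alpha:\mathcal{A}\to U$ an algebra morphism and $\beta:\mathcal{A}\to U_L$ a Lie algebra morphism such that for all $a_1,a_2\in\mathcal{A}$: $\alpha(\{a_1,a_2\})=\alpha(a_1)\beta(a_2)-\beta(a_2)\alpha(a_1)$ and $\beta(a_1a_2)=\alpha(a_1)\beta(a_2)+\alpha(a_2)\beta(a_1)$, and which is universal: for any algebra $U'$, algebra morphism $\alpha':\mathcal{A}\to U'$ and Lie algebra morphism $\beta':\mathcal{A}\to U'_L$ satisfying the same two identities, there is a unique algebra morphism $\gamma:U\to U'$ with $\gamma\circ\alpha=\alpha'$ and $\gamma\circ\beta=\beta'$. $U(\mathcal{A})$ is viewed as an $\mathcal{A}$-module via $a u:=\alpha_{\mathcal{A}}(a)u$, and $\mathcal{B}$ as an $\mathcal{A}$-module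 via $\pi$, so that $\pi(a)\otimes u=1_{\mathcal{B}}\otimes\alpha_{\mathcal{A}}(a)u$ in $\mathcal{B}\otimes_{\mathcal{A}}U(\mathcal{A})$. The $\mathcal{B}$-module $\mathcal{B}\otimes_{\mathcal{A}}U(\mathcal{A})$ is a unitary $R$-algebra with the (well-defined) product $$(\pi(a_1)\otimes u_1)\cdot(\pi(a_2)\otimes u_2):=1_{\mathcal{B}}\otimes\alpha_{\mathcal{A}}(a_1)u_1\alpha_{\mathcal{A}}(a_2)u_2\qquad(a_i\in\mathcal{A},\ u_i\in U(\mathcal{A})),$$ and the maps $\alpha,\beta$ in the claim are well-defined. *)

theory Defs
  imports "HOL-Algebra.Module" "HOL-Algebra.QuotRing" "HOL-Algebra.Free_Abelian_Groups"
begin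

section \<open>Associative algebras, Lie algebras and their morphisms\<close>

text \<open>The library locale \<^locale>\<open>algebra\<close> is the commutative case; the following one does not
  assume that the multiplication of \<open>M\<close> is commutative.\<close>

locale assoc_algebra = module R M + ring M
  for R :: "('r, 'k) ring_scheme" (structure) and M :: "('r, 'm, 'z) module_scheme" (structure) +
  assumes smult_mult_left:
    "\<lbrakk>r \<in> carrier R; x \<in> carrier M; y \<in> carrier M\<rbrakk> \<Longrightarrow>
      (r \<odot>\<^bsub>M\<^esub> x) \<otimes>\<^bsub>M\<^esub> y = r \<odot>\<^bsub>M\<^esub> (x \<otimes>\<^bsub>M\<^esub> y)"
    and smult_mult_right:
    "\<lbrakk>r \<in> carrier R; x \<in> carrier M; y \<in> carrier M\<rbrakk> \<Longrightarrow>
      x \<otimes>\<^bsub>M\<^esub> (r \<odot>\<^bsub>M\<^esub> y) = r \<odot>\<^bsub>M\<^esub> (x \<otimes>\<^bsub>M\<^esub> y)"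

locale lie_algebra = module R M
  for R :: "('r, 'k) ring_scheme" (structure) and M :: "('r, 'm, 'z) module_scheme" (structure) +
  fixes br :: "'m \<Rightarrow> 'm \<Rightarrow> 'm"
  assumes br_closed: "\<lbrakk>x \<in> carrier M; y \<in> carrier M\<rbrakk> \<Longrightarrow> br x y \<in> carrier M"
    and br_add_left: "\<lbrakk>x \<in> carrier M; y \<in> carrier M; z \<in> carrier M\<rbrakk> \<Longrightarrow>
      br (x \<oplus>\<^bsub>M\<^esub> y) z = br x z \<oplus>\<^bsub>M\<^esub> br y z"
    and br_add_right: "\<lbrakk>x \<in> carrier M; y \<in> carrier M; z \<in> carrier M\<rbrakk> \<Longrightarrow>
      br x (y \<oplus>\<^bsub>M\<^esub> z) = br x y \<oplus>\<^bsub>M\<^esub> br x z"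
    and br_smult_left: "\<lbrakk>r \<in> carrier R; x \<in> carrier M; y \<in> carrier M\<rbrakk> \<Longrightarrow>
      br (r \<odot>\<^bsub>M\<^esub> x) y = r \<odot>\<^bsub>M\<^esub> br x y"
    and br_smult_right: "\<lbrakk>r \<in> carrier R; x \<in> carrier M; y \<in> carrier M\<rbrakk> \<Longrightarrow>
      br x (r \<odot>\<^bsub>M\<^esub> y) = r \<odot>\<^bsub>M\<^esub> br x y"
    and br_alternating: "x \<in> carrier M \<Longrightarrow> br x x = \<zero>\<^bsub>M\<^esub>"
    and br_jacobi: "\<lbrakk>x \<in> carrier M; y \<in> carrier M; z \<in> carrier M\<rbrakk> \<Longrightarrow>
      br x (br y z) \<oplus>\<^bsub>M\<^esub> br y (br z x) \<oplus>\<^bsub>M\<^esub> br z (br x y) = \<zero>\<^bsub>M\<^esub>"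

definition commutator :: "('r, 'm, 'z) module_scheme \<Rightarrow> 'm \<Rightarrow> 'm \<Rightarrow> 'm"
  where "commutator M x y = (x \<otimes>\<^bsub>M\<^esub> y) \<ominus>\<^bsub>M\<^esub> (y \<otimes>\<^bsub>M\<^esub> x)"

definition linear_maps ::
    "('r, 'k) ring_scheme \<Rightarrow> ('r, 'm, 'y) module_scheme \<Rightarrow> ('r, 'n, 'z) module_scheme \<Rightarrow> ('m \<Rightarrow> 'n) set"
  where "linear_maps R M N = {f \<in> carrier M \<rightarrow> carrier N.
    (\<forall>x \<in> carrier M. \<forall>y \<in> carrier M. f (x \<oplus>\<^bsub>M\<^esub> y) = f x \<oplus>\<^bsub>N\<^esub> f y) \<and>
    (\<forall>r \<in> carrier R. \<forall>x \<in> carrier M. f (r \<odot>\<^bsub>M\<^esub> x) = r \<odot>\<^bsub>N\<^esub> f x)}"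

definition alg_hom ::
    "('r, 'k) ring_scheme \<Rightarrow> ('r, 'm, 'y) module_scheme \<Rightarrow> ('r, 'n, 'z) module_scheme \<Rightarrow> ('m \<Rightarrow> 'n) set"
  where "alg_hom R M N = ring_hom M N \<inter> linear_maps R M N"

definition lie_hom ::
    "('r, 'k) ring_scheme \<Rightarrow> ('r, 'm, 'y) module_scheme \<Rightarrow> ('m \<Rightarrow> 'm \<Rightarrow> 'm) \<Rightarrow>
     ('r, 'n, 'z) module_scheme \<Rightarrow> ('n \<Rightarrow> 'n \<Rightarrow> 'n) \<Rightarrow> ('m \<Rightarrow> 'n) set"
  where "lie_hom R M br N br' = {f \<in> linear_maps R M N.
    \<forall>x \<in> carrier M. \<forall>y \<in> carrier M. f (br x y) = br' (f x) (f y)}"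

text \<open>The quotient of an algebra by a two-sided ideal. The scalar multiplication is defined on
  cosets in the style of \<^const>\<open>rcoset_mult\<close>.\<close>

definition alg_quot :: "('r, 'm, 'z) module_scheme \<Rightarrow> 'm set \<Rightarrow> ('r, 'm set) module"
  where "alg_quot M J = ring.extend (M Quot J)
    (module.fields (\<lambda>r X. \<Union>x\<in>X. J +>\<^bsub>M\<^esub> (r \<odot>\<^bsub>M\<^esub> x)))"


section \<open>Poisson algebras\<close>

record ('r, 'a) poisson = "('r, 'a) module" +
  bracket :: "'a \<Rightarrow> 'a \<Rightarrow> 'a" (\<open>\<lbrace>_,_\<rbrace>\<index>\<close>)

locale poisson_algebra = algebra R A + lie_algebra R A "bracket A"
  for R :: "('r, 'k) ring_scheme" (structure) and A :: "('r, 'a, 'y) poisson_scheme" (structure) +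
  assumes leibniz:
    "\<lbrakk>x \<in> carrier A; y \<in> carrier A; z \<in> carrier A\<rbrakk> \<Longrightarrow>
      \<lbrace>x \<otimes>\<^bsub>A\<^esub> y, z\<rbrace>\<^bsub>A\<^esub> = x \<otimes>\<^bsub>A\<^esub> \<lbrace>y, z\<rbrace>\<^bsub>A\<^esub> \<oplus>\<^bsub>A\<^esub> y \<otimes>\<^bsub>A\<^esub> \<lbrace>x, z\<rbrace>\<^bsub>A\<^esub>"

locale poisson_ideal = poisson_algebra R A + submodule I R A + ideal I A
  for R :: "('r, 'k) ring_scheme" (structure) and A :: "('r, 'a, 'y) poisson_scheme" (structure)
    and I :: "'a set" +
  assumes lie_ideal: "\<lbrakk>i \<in> I; x \<in> carrier A\<rbrakk> \<Longrightarrow> \<lbrace>i, x\<rbrace>\<^bsub>A\<^esub> \<in> I"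

definition poisson_quot :: "('r, 'a, 'z) poisson_scheme \<Rightarrow> 'a set \<Rightarrow> ('r, 'a set) poisson"
  where "poisson_quot A I = module.extend (alg_quot A I)
    (poisson.fields (\<lambda>X Y. \<Union>x\<in>X. \<Union>y\<in>Y. I +>\<^bsub>A\<^esub> \<lbrace>x, y\<rbrace>\<^bsub>A\<^esub>))"


section \<open>Poisson enveloping algebras\<close>

locale poisson_pair = poisson_algebra R A + U: assoc_algebra R U
  for R :: "('r, 'k) ring_scheme" (structure) and A :: "('r, 'a, 'y) poisson_scheme" (structure)
    and U :: "('r, 'u, 'z) module_scheme" (structure) +
  fixes \<alpha> :: "'a \<Rightarrow> 'u" and \<beta> :: "'a \<Rightarrow> 'u"
  assumes alpha_hom: "\<alpha> \<in> alg_hom R A U"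
    and beta_hom: "\<beta> \<in> lie_hom R A (bracket A) U (commutator U)"
    and alpha_bracket: "\<lbrakk>x \<in> carrier A; y \<in> carrier A\<rbrakk> \<Longrightarrow>
      \<alpha> \<lbrace>x, y\<rbrace>\<^bsub>A\<^esub> = \<alpha> x \<otimes>\<^bsub>U\<^esub> \<beta> y \<ominus>\<^bsub>U\<^esub> \<beta> y \<otimes>\<^bsub>U\<^esub> \<alpha> x"
    and beta_mult: "\<lbrakk>x \<in> carrier A; y \<in> carrier A\<rbrakk> \<Longrightarrow>
      \<beta> (x \<otimes>\<^bsub>A\<^esub> y) = \<alpha> x \<otimes>\<^bsub>U\<^esub> \<beta> y \<oplus>\<^bsub>U\<^esub> \<alpha> y \<otimes>\<^bsub>U\<^esub> \<beta> x"

text \<open>HOL cannot quantify over types inside a formula, so the type \<open>'d\<close> carrying the test algebras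
  \<open>U'\<close> is a parameter. The universal property of the literature is the conjunction of all its
  instances. The instance \<open>'d = 'u\<close> already implies that \<open>U\<close> is generated as an algebra by the images
  of \<open>\<alpha>\<close> and \<open>\<beta>\<close>. An algebra morphism is only determined on the carrier of \<open>U\<close>, hence the
  normalisation by \<^const>\<open>extensional\<close> in the uniqueness part.\<close>

definition poisson_enveloping ::
    "'d itself \<Rightarrow> ('r, 'k) ring_scheme \<Rightarrow> ('r, 'a, 'y) poisson_scheme \<Rightarrow>
     ('r, 'u, 'z) module_scheme \<Rightarrow> ('a \<Rightarrow> 'u) \<Rightarrow> ('a \<Rightarrow> 'u) \<Rightarrow> bool"
  where "poisson_enveloping (_ :: 'd itself) R A U \<alpha> \<beta> \<longleftrightarrow>
    poisson_pair R A U \<alpha> \<beta> \<and>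
    (\<forall>(U' :: ('r, 'd) module) \<alpha>' \<beta>'. poisson_pair R A U' \<alpha>' \<beta>' \<longrightarrow>
      (\<exists>!\<gamma>. \<gamma> \<in> alg_hom R U U' \<and> \<gamma> \<in> extensional (carrier U) \<and>
        (\<forall>a \<in> carrier A. \<gamma> (\<alpha> a) = \<alpha>' a \<and> \<gamma> (\<beta> a) = \<beta>' a)))"


section \<open>Tensor products of modules over a commutative ring\<close>

text \<open>For modules \<open>M\<close>, \<open>N\<close> over a commutative ring \<open>S\<close>, the tensor product is the quotient of the
  free abelian group on \<open>M \<times> N\<close> by the subgroup generated by the usual relations. The group of
  formal sums is written multiplicatively in the library, but its operation is the addition of
  \<^typ>\<open>'a \<Rightarrow>\<^sub>0 int\<close>.\<close>

definition formal_tensors ::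
    "('s, 'm, 'y) module_scheme \<Rightarrow> ('s, 'n, 'z) module_scheme \<Rightarrow> ('m \<times> 'n \<Rightarrow>\<^sub>0 int) monoid"
  where "formal_tensors M N = free_Abelian_group (carrier M \<times> carrier N)"

definition tensor_relations ::
    "('s, 'k) ring_scheme \<Rightarrow> ('s, 'm, 'y) module_scheme \<Rightarrow> ('s, 'n, 'z) module_scheme \<Rightarrow>
     ('m \<times> 'n \<Rightarrow>\<^sub>0 int) set"
  where "tensor_relations S M N =
    {frag_of (m \<oplus>\<^bsub>M\<^esub> m', n) - frag_of (m, n) - frag_of (m', n) | m m' n.
       m \<in> carrier M \<and> m' \<in> carrier M \<and> n \<in> carrier N} \<union>
    {frag_of (m, n \<oplus>\<^bsub>N\<^esub> n') - frag_of (m, n) - frag_of (m, n') | m n n'.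
       m \<in> carrier M \<and> n \<in> carrier N \<and> n' \<in> carrier N} \<union>
    {frag_of (s \<odot>\<^bsub>M\<^esub> m, n) - frag_of (m, s \<odot>\<^bsub>N\<^esub> n) | s m n.
       s \<in> carrier S \<and> m \<in> carrier M \<and> n \<in> carrier N}"

definition tensor_kernel ::
    "('s, 'k) ring_scheme \<Rightarrow> ('s, 'm, 'y) module_scheme \<Rightarrow> ('s, 'n, 'z) module_scheme \<Rightarrow>
     ('m \<times> 'n \<Rightarrow>\<^sub>0 int) set"
  where "tensor_kernel S M N = generate (formal_tensors M N) (tensor_relations S M N)"

definition tensor_group ::
    "('s, 'k) ring_scheme \<Rightarrow> ('s, 'm, 'y) module_scheme \<Rightarrow> ('s, 'n, 'z) module_scheme \<Rightarrow>
     ('m \<times> 'n \<Rightarrow>\<^sub>0 int) set monoid"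
  where "tensor_group S M N = formal_tensors M N Mod tensor_kernel S M N"

definition tensor ::
    "('s, 'k) ring_scheme \<Rightarrow> ('s, 'm, 'y) module_scheme \<Rightarrow> ('s, 'n, 'z) module_scheme \<Rightarrow>
     'm \<Rightarrow> 'n \<Rightarrow> ('m \<times> 'n \<Rightarrow>\<^sub>0 int) set"
  where "tensor S M N m n = tensor_kernel S M N #>\<^bsub>formal_tensors M N\<^esub> frag_of (m, n)"

text \<open>The endomorphism of the tensor product induced by \<open>f \<otimes> id\<close>, for a linear \<open>f\<close> on \<open>M\<close>.\<close>

definition tensor_map_left ::
    "('s, 'k) ring_scheme \<Rightarrow> ('s, 'm, 'y) module_scheme \<Rightarrow> ('s, 'n, 'z) module_scheme \<Rightarrow>
     ('m \<Rightarrow> 'm) \<Rightarrow> ('m \<times> 'n \<Rightarrow>\<^sub>0 int) set \<Rightarrow> ('m \<times> 'n \<Rightarrow>\<^sub>0 int) set"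
  where "tensor_map_left S M N f X =
    (\<Union>x\<in>X. tensor_kernel S M N #>\<^bsub>formal_tensors M N\<^esub>
       frag_extend (\<lambda>(m, n). frag_of (f m, n)) x)"

text \<open>The ring \<open>M\<close> as a left module over a ring \<open>S\<close> via a ring morphism \<open>f\<close> from \<open>S\<close> to \<open>M\<close>.\<close>

definition module_via :: "('s \<Rightarrow> 'm) \<Rightarrow> ('m, 'z) ring_scheme \<Rightarrow> ('s, 'm) module"
  where "module_via f M = ring.extend (ring.truncate M)
    (module.fields (\<lambda>s x. f s \<otimes>\<^bsub>M\<^esub> x))"


section \<open>The candidate for the enveloping algebra of a quotient\<close>

abbreviation quot_map :: "('r, 'a, 'z) poisson_scheme \<Rightarrow> 'a set \<Rightarrow> 'a \<Rightarrow> 'a set"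
  where "quot_map A I a \<equiv> I +>\<^bsub>A\<^esub> a"

text \<open>In the following \<open>\<alpha>\<close> is the structure map from \<open>A\<close> to \<open>U\<close>; \<open>bc_tensor A I U \<alpha> b u\<close> is the pure
  tensor of \<open>b\<close> and \<open>u\<close> over \<open>A\<close>.\<close>

definition bc_tensor ::
    "('r, 'a, 'y) poisson_scheme \<Rightarrow> 'a set \<Rightarrow> ('r, 'u, 'z) module_scheme \<Rightarrow> ('a \<Rightarrow> 'u) \<Rightarrow>
     'a set \<Rightarrow> 'u \<Rightarrow> ('a set \<times> 'u \<Rightarrow>\<^sub>0 int) set"
  where "bc_tensor A I U \<alpha> =
    tensor A (module_via (quot_map A I) (poisson_quot A I)) (module_via \<alpha> U)"

text \<open>The algebra on the tensor product of \<open>A/I\<close> and \<open>U\<close> over \<open>A\<close>. Since the canonical surjection is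
  onto, every element of the tensor product is a pure tensor, so it suffices to define the product
  on pure tensors. A scalar \<open>r\<close> acts through the left factor.\<close>

definition bc_algebra ::
    "('r, 'a, 'y) poisson_scheme \<Rightarrow> 'a set \<Rightarrow> ('r, 'u, 'z) module_scheme \<Rightarrow> ('a \<Rightarrow> 'u) \<Rightarrow>
     ('r, ('a set \<times> 'u \<Rightarrow>\<^sub>0 int) set) module"
  where "bc_algebra A I U \<alpha> =
    (let B = poisson_quot A I; \<pi> = quot_map A I;
         M = module_via \<pi> B; N = module_via \<alpha> U; t = bc_tensor A I U \<alpha> in
     \<lparr>carrier = carrier (tensor_group A M N),
      monoid.mult = (\<lambda>x y. THE z. \<exists>a\<^sub>1 \<in> carrier A. \<exists>a\<^sub>2 \<in> carrier A. \<exists>u\<^sub>1 \<in> carrier U. \<exists>u\<^sub>2 \<in> carrier U.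
        x = t (\<pi> a\<^sub>1) u\<^sub>1 \<and> y = t (\<pi> a\<^sub>2) u\<^sub>2 \<and>
        z = t \<one>\<^bsub>B\<^esub> (\<alpha> a\<^sub>1 \<otimes>\<^bsub>U\<^esub> u\<^sub>1 \<otimes>\<^bsub>U\<^esub> \<alpha> a\<^sub>2 \<otimes>\<^bsub>U\<^esub> u\<^sub>2)),
      monoid.one = t \<one>\<^bsub>B\<^esub> \<one>\<^bsub>U\<^esub>,
      ring.zero = monoid.one (tensor_group A M N),
      ring.add = monoid.mult (tensor_group A M N),
      smult = (\<lambda>r. tensor_map_left A M N (\<lambda>b. r \<odot>\<^bsub>B\<^esub> b))\<rparr>)"

definition env_ideal ::
    "('r, 'a, 'y) poisson_scheme \<Rightarrow> 'a set \<Rightarrow> ('r, 'u, 'z) module_scheme \<Rightarrow> ('a \<Rightarrow> 'u) \<Rightarrow> ('a \<Rightarrow> 'u) \<Rightarrow>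
     ('a set \<times> 'u \<Rightarrow>\<^sub>0 int) set set"
  where "env_ideal A I U \<alpha> \<beta> =
    Idl\<^bsub>bc_algebra A I U \<alpha>\<^esub> ((\<lambda>i. bc_tensor A I U \<alpha> \<one>\<^bsub>poisson_quot A I\<^esub> (\<beta> i)) ` I)"

definition env_quot ::
    "('r, 'a, 'y) poisson_scheme \<Rightarrow> 'a set \<Rightarrow> ('r, 'u, 'z) module_scheme \<Rightarrow> ('a \<Rightarrow> 'u) \<Rightarrow> ('a \<Rightarrow> 'u) \<Rightarrow>
     ('r, ('a set \<times> 'u \<Rightarrow>\<^sub>0 int) set set) module"
  where "env_quot A I U \<alpha> \<beta> = alg_quot (bc_algebra A I U \<alpha>) (env_ideal A I U \<alpha> \<beta>)"

text \<open>For \<open>\<theta> \<in> {\<alpha>, \<beta>}\<close>, the map on \<open>A/I\<close> that sends the class of \<open>a\<close> to the class of the tensor of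
  \<open>1\<close> and \<open>\<theta> a\<close>. The elements of a coset \<open>X\<close> are exactly its preimages in \<open>A\<close>.\<close>

definition env_map ::
    "('r, 'a, 'y) poisson_scheme \<Rightarrow> 'a set \<Rightarrow> ('r, 'u, 'z) module_scheme \<Rightarrow> ('a \<Rightarrow> 'u) \<Rightarrow> ('a \<Rightarrow> 'u) \<Rightarrow>
     ('a \<Rightarrow> 'u) \<Rightarrow> 'a set \<Rightarrow> ('a set \<times> 'u \<Rightarrow>\<^sub>0 int) set set"
  where "env_map A I U \<alpha> \<beta> \<theta> X = the_elem ((\<lambda>a.
    env_ideal A I U \<alpha> \<beta> +>\<^bsub>bc_algebra A I U \<alpha>\<^esub>
      bc_tensor A I U \<alpha> \<one>\<^bsub>poisson_quot A I\<^esub> (\<theta> a)) ` X)"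

end

theory Submission
  imports Defs "HOL-Algebra.Subrings"
begin

text \<open>Write \<open>B = A/I\<close>, \<open>U = U(A)\<close> and \<open>E\<close> for the quotient of \<open>B \<otimes>\<^sub>A U\<close> by \<open>I\<^sub>B\<close>. Since
  \<open>\<pi>(a) \<otimes> u = 1 \<otimes> \<alpha>(a) u\<close>, the map \<open>\<tau>\<close> sending \<open>u\<close> to \<open>1 \<otimes> u\<close> is onto, so \<open>E\<close> is a
  quotient of \<open>U\<close>, by a surjection called \<open>proj\<close>. A Poisson pair on \<open>B\<close> with values in an algebra \<open>V\<close>
  pulls back to \<open>A\<close> and thus induces a morphism from \<open>U\<close> to \<open>V\<close>, which kills \<open>\<alpha>(I)\<close> and \<open>\<beta>(I)\<close>. The
  kernel of \<open>proj\<close> is the smallest two-sided ideal containing \<open>\<alpha>(I)\<close> and \<open>\<beta>(I)\<close>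
  (\<open>proj_kernel_minimal\<close>): tensoring with \<open>B\<close> kills the first, dividing by \<open>I\<^sub>B\<close> the second. So the
  morphism factors through \<open>E\<close>, and uniquely so because \<open>proj\<close> is onto. This formal argument is
  \<open>poisson_enveloping_quotient\<close>.

  What has to be checked is that \<open>\<tau>\<close> turns the product of \<open>U\<close> into the prescribed product on the tensor
  product, that is, that the kernel of \<open>\<tau>\<close>, which is the right ideal \<open>\<alpha>(I) U\<close>, is also a left ideal.
  The elements of \<open>U\<close> that map the kernel into itself by left multiplication form a subalgebra. It
  contains \<open>\<alpha>(A)\<close> because \<open>I\<close> is an ideal, and \<open>\<beta>(A)\<close> because
  \<open>\<beta>(a) \<alpha>(i) = \<alpha>(i) \<beta>(a) - \<alpha>({i, a})\<close> and \<open>I\<close> is a Lie ideal. By the universal property \<open>U\<close> is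
  generated by \<open>\<alpha>(A)\<close> and \<open>\<beta>(A)\<close> (\<open>poisson_enveloping_generated\<close>), so it is all of \<open>U\<close>
  (\<open>tau_kernel_mult_left\<close>).

  The kernel of \<open>\<tau>\<close> is never computed as a set. All that is needed is that it contains \<open>\<alpha>(I) U\<close> and
  that an additive map killing \<open>\<alpha>(I) U\<close> kills it (\<open>additive_kills_tau_kernel\<close>), which is the universal
  property of the tensor product.\<close>

section \<open>Morphisms of algebras\<close>

lemma alg_homD:
  assumes "f \<in> alg_hom R M N"
  shows "x \<in> carrier M \<Longrightarrow> f x \<in> carrier N"
    and "\<lbrakk>x \<in> carrier M; y \<in> carrier M\<rbrakk> \<Longrightarrow> f (x \<oplus>\<^bsub>M\<^esub> y) = f x \<oplus>\<^bsub>N\<^esub> f y"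
    and "\<lbrakk>x \<in> carrier M; y \<in> carrier M\<rbrakk> \<Longrightarrow> f (x \<otimes>\<^bsub>M\<^esub> y) = f x \<otimes>\<^bsub>N\<^esub> f y"
    and "f \<one>\<^bsub>M\<^esub> = \<one>\<^bsub>N\<^esub>"
    and "\<lbrakk>r \<in> carrier R; x \<in> carrier M\<rbrakk> \<Longrightarrow> f (r \<odot>\<^bsub>M\<^esub> x) = r \<odot>\<^bsub>N\<^esub> f x"
  using assms by (auto simp: alg_hom_def linear_maps_def ring_hom_def)

lemma alg_homI:
  assumes "\<And>x. x \<in> carrier M \<Longrightarrow> f x \<in> carrier N"
    and "\<And>x y. \<lbrakk>x \<in> carrier M; y \<in> carrier M\<rbrakk> \<Longrightarrow> f (x \<oplus>\<^bsub>M\<^esub> y) = f x \<oplus>\<^bsub>N\<^esub> f y"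
    and "\<And>x y. \<lbrakk>x \<in> carrier M; y \<in> carrier M\<rbrakk> \<Longrightarrow> f (x \<otimes>\<^bsub>M\<^esub> y) = f x \<otimes>\<^bsub>N\<^esub> f y"
    and "f \<one>\<^bsub>M\<^esub> = \<one>\<^bsub>N\<^esub>"
    and "\<And>r x. \<lbrakk>r \<in> carrier R; x \<in> carrier M\<rbrakk> \<Longrightarrow> f (r \<odot>\<^bsub>M\<^esub> x) = r \<odot>\<^bsub>N\<^esub> f x"
  shows "f \<in> alg_hom R M N"
  using assms by (auto simp: alg_hom_def linear_maps_def ring_hom_def)

lemma alg_hom_comp:
  assumes "f \<in> alg_hom R M N" "g \<in> alg_hom R N P"
  shows "(\<lambda>x. g (f x)) \<in> alg_hom R M P"
  by (rule alg_homI) (simp_all add: alg_homD[OF assms(1)] alg_homD[OF assms(2)])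

lemma lie_homD:
  assumes "f \<in> lie_hom R M br N br'"
  shows "x \<in> carrier M \<Longrightarrow> f x \<in> carrier N"
    and "\<lbrakk>x \<in> carrier M; y \<in> carrier M\<rbrakk> \<Longrightarrow> f (x \<oplus>\<^bsub>M\<^esub> y) = f x \<oplus>\<^bsub>N\<^esub> f y"
    and "\<lbrakk>r \<in> carrier R; x \<in> carrier M\<rbrakk> \<Longrightarrow> f (r \<odot>\<^bsub>M\<^esub> x) = r \<odot>\<^bsub>N\<^esub> f x"
    and "\<lbrakk>x \<in> carrier M; y \<in> carrier M\<rbrakk> \<Longrightarrow> f (br x y) = br' (f x) (f y)"
  using assms by (auto simp: lie_hom_def linear_maps_def)

lemma lie_homI:
  assumes "\<And>x. x \<in> carrier M \<Longrightarrow> f x \<in> carrier N"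
    and "\<And>x y. \<lbrakk>x \<in> carrier M; y \<in> carrier M\<rbrakk> \<Longrightarrow> f (x \<oplus>\<^bsub>M\<^esub> y) = f x \<oplus>\<^bsub>N\<^esub> f y"
    and "\<And>r x. \<lbrakk>r \<in> carrier R; x \<in> carrier M\<rbrakk> \<Longrightarrow> f (r \<odot>\<^bsub>M\<^esub> x) = r \<odot>\<^bsub>N\<^esub> f x"
    and "\<And>x y. \<lbrakk>x \<in> carrier M; y \<in> carrier M\<rbrakk> \<Longrightarrow> f (br x y) = br' (f x) (f y)"
  shows "f \<in> lie_hom R M br N br'"
  using assms by (auto simp: lie_hom_def linear_maps_def)

lemma alg_hom_ring_hom_ring:
  assumes "f \<in> alg_hom R M N" "ring M" "ring N"
  shows "ring_hom_ring M N f"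
  using assms ring_hom_ringI2 unfolding alg_hom_def by blast

lemma alg_hom_zero:
  assumes "f \<in> alg_hom R M N" "ring M" "ring N"
  shows "f \<zero>\<^bsub>M\<^esub> = \<zero>\<^bsub>N\<^esub>"
  using assms ring_hom_zero unfolding alg_hom_def by blast

lemma alg_hom_minus:
  assumes "f \<in> alg_hom R M N" "ring M" "ring N" "x \<in> carrier M" "y \<in> carrier M"
  shows "f (x \<ominus>\<^bsub>M\<^esub> y) = f x \<ominus>\<^bsub>N\<^esub> f y"
proof -
  interpret ring_hom_ring M N f by (rule alg_hom_ring_hom_ring[OF assms(1-3)])
  show ?thesis using assms(4,5) by (simp add: a_minus_def)
qed

lemma (in algebra) algebra_imp_assoc_algebra: "assoc_algebra R M"
proof
  fix r x y assume *: "r \<in> carrier R" "x \<in> carrier M" "y \<in> carrier M"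
  show "(r \<odot>\<^bsub>M\<^esub> x) \<otimes>\<^bsub>M\<^esub> y = r \<odot>\<^bsub>M\<^esub> (x \<otimes>\<^bsub>M\<^esub> y)" using * by (rule smult_assoc2)
  then show "x \<otimes>\<^bsub>M\<^esub> (r \<odot>\<^bsub>M\<^esub> y) = r \<odot>\<^bsub>M\<^esub> (x \<otimes>\<^bsub>M\<^esub> y)"
    using * smult_assoc2[of r y x] by (simp add: m_comm)
qed

lemma (in assoc_algebra) smult_eq_mult:
  assumes "r \<in> carrier R" "x \<in> carrier M"
  shows "r \<odot>\<^bsub>M\<^esub> x = (r \<odot>\<^bsub>M\<^esub> \<one>\<^bsub>M\<^esub>) \<otimes>\<^bsub>M\<^esub> x"
  using assms by (simp add: smult_mult_left)

text \<open>Apart from the existence of negatives, which a surjection transports, the axioms of a ring, an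
  algebra and a Poisson algebra are identities. So they pass to any structure, not assumed to satisfy
  anything, onto which such an object maps compatibly with all operations. The quotients and the
  algebra on the tensor product are recognised in this way, without computing with cosets.\<close>

lemma ring_surj_image:
  assumes M: "ring M" and f: "f \<in> ring_hom M N"
    and zero: "f \<zero>\<^bsub>M\<^esub> = \<zero>\<^bsub>N\<^esub>" and surj: "f ` carrier M = carrier N"
  shows "ring N"
proof -
  interpret M: ring M by (rule M)
  have N: "\<And>x. x \<in> carrier N \<Longrightarrow> \<exists>m \<in> carrier M. x = f m" using surj by blast
  note h = ring_hom_closed[OF f] ring_hom_add[OF f, symmetric] ring_hom_mult[OF f, symmetric]
    ring_hom_one[OF f, symmetric] zero[symmetric]
  show ?thesis
  proof (rule ringI)
    show "abelian_group N"
    proof (rule abelian_groupI)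
      show "\<exists>y\<in>carrier N. y \<oplus>\<^bsub>N\<^esub> x = \<zero>\<^bsub>N\<^esub>" if "x \<in> carrier N" for x
      proof -
        obtain m where m: "m \<in> carrier M" "x = f m" using N \<open>x \<in> carrier N\<close> by blast
        then have "f (\<ominus>\<^bsub>M\<^esub> m) \<oplus>\<^bsub>N\<^esub> x = \<zero>\<^bsub>N\<^esub>" by (simp add: h M.l_neg)
        then show ?thesis using m h(1) by blast
      qed
    qed (auto dest!: N simp: h M.a_ac)
    show "monoid N" by (rule monoidI) (auto dest!: N simp: h M.m_assoc)
  qed (auto dest!: N simp: h M.l_distr M.r_distr)
qed

lemma assoc_algebra_surj_image:
  assumes M: "assoc_algebra R M" and f: "f \<in> alg_hom R M N"
    and zero: "f \<zero>\<^bsub>M\<^esub> = \<zero>\<^bsub>N\<^esub>" and surj: "f ` carrier M = carrier N"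
  shows "assoc_algebra R N"
proof -
  interpret M: assoc_algebra R M by (rule M)
  have "ring N"
    using ring_surj_image[OF M.ring_axioms _ zero surj] f unfolding alg_hom_def by blast
  then interpret N: ring N .
  have N: "\<And>x. x \<in> carrier N \<Longrightarrow> \<exists>m \<in> carrier M. x = f m" using surj by blast
  note h = alg_homD(1)[OF f] alg_homD(2,3,5)[OF f, symmetric]
  show ?thesis
    by unfold_locales (auto dest!: N simp: h M.smult_l_distr M.smult_r_distr M.smult_assoc1
        M.smult_mult_left M.smult_mult_right)
qed

lemma poisson_algebra_surj_image:
  assumes A: "poisson_algebra R A" and f: "f \<in> alg_hom R A B"
    and br: "\<And>x y. \<lbrakk>x \<in> carrier A; y \<in> carrier A\<rbrakk> \<Longrightarrow> f \<lbrace>x, y\<rbrace>\<^bsub>A\<^esub> = \<lbrace>f x, f y\<rbrace>\<^bsub>B\<^esub>"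
    and zero: "f \<zero>\<^bsub>A\<^esub> = \<zero>\<^bsub>B\<^esub>" and surj: "f ` carrier A = carrier B"
  shows "poisson_algebra R B"
proof -
  interpret A: poisson_algebra R A by (rule A)
  interpret B: assoc_algebra R B
    by (rule assoc_algebra_surj_image[OF A.algebra_imp_assoc_algebra f zero surj])
  have B: "\<And>x. x \<in> carrier B \<Longrightarrow> \<exists>m \<in> carrier A. x = f m" using surj by blast
  note h = alg_homD(1)[OF f] alg_homD(2,3,5)[OF f, symmetric] br[symmetric] A.br_closed zero[symmetric]
  show ?thesis
  proof
    show "x \<otimes>\<^bsub>B\<^esub> y = y \<otimes>\<^bsub>B\<^esub> x" if "x \<in> carrier B" "y \<in> carrier B" for x y
      using that by (auto dest!: B simp: h A.m_comm)
    show "\<lbrace>x, \<lbrace>y, z\<rbrace>\<^bsub>B\<^esub>\<rbrace>\<^bsub>B\<^esub> \<oplus>\<^bsub>B\<^esub> \<lbrace>y, \<lbrace>z, x\<rbrace>\<^bsub>B\<^esub>\<rbrace>\<^bsub>B\<^esub> \<oplus>\<^bsub>B\<^esub> \<lbrace>z, \<lbrace>x, y\<rbrace>\<^bsub>B\<^esub>\<rbrace>\<^bsub>B\<^esub> = \<zero>\<^bsub>B\<^esub>"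
      if "x \<in> carrier B" "y \<in> carrier B" "z \<in> carrier B" for x y z
      using that by (auto dest!: B simp: h A.br_jacobi)
    show "\<lbrace>x \<otimes>\<^bsub>B\<^esub> y, z\<rbrace>\<^bsub>B\<^esub> = x \<otimes>\<^bsub>B\<^esub> \<lbrace>y, z\<rbrace>\<^bsub>B\<^esub> \<oplus>\<^bsub>B\<^esub> y \<otimes>\<^bsub>B\<^esub> \<lbrace>x, z\<rbrace>\<^bsub>B\<^esub>"
      if "x \<in> carrier B" "y \<in> carrier B" "z \<in> carrier B" for x y z
      using that by (auto dest!: B simp: h A.leibniz)
  qed (auto dest!: B simp: h A.smult_assoc2 A.br_add_left A.br_add_right A.br_smult_left
      A.br_smult_right A.br_alternating)
qed

section \<open>Quotient algebras\<close>

lemma alg_quot_simps: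
  "carrier (alg_quot M J) = carrier (M Quot J)"
  "x \<otimes>\<^bsub>alg_quot M J\<^esub> y = x \<otimes>\<^bsub>M Quot J\<^esub> y"
  "\<one>\<^bsub>alg_quot M J\<^esub> = \<one>\<^bsub>M Quot J\<^esub>"
  "x \<oplus>\<^bsub>alg_quot M J\<^esub> y = x \<oplus>\<^bsub>M Quot J\<^esub> y"
  "\<zero>\<^bsub>alg_quot M J\<^esub> = \<zero>\<^bsub>M Quot J\<^esub>"
  "r \<odot>\<^bsub>alg_quot M J\<^esub> X = (\<Union>x\<in>X. J +>\<^bsub>M\<^esub> (r \<odot>\<^bsub>M\<^esub> x))"
  by (simp_all add: alg_quot_def ring.defs module.defs)

lemma poisson_quot_simps:
  "carrier (poisson_quot A I) = carrier (alg_quot A I)"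
  "x \<otimes>\<^bsub>poisson_quot A I\<^esub> y = x \<otimes>\<^bsub>alg_quot A I\<^esub> y"
  "\<one>\<^bsub>poisson_quot A I\<^esub> = \<one>\<^bsub>alg_quot A I\<^esub>"
  "x \<oplus>\<^bsub>poisson_quot A I\<^esub> y = x \<oplus>\<^bsub>alg_quot A I\<^esub> y"
  "\<zero>\<^bsub>poisson_quot A I\<^esub> = \<zero>\<^bsub>alg_quot A I\<^esub>"
  "r \<odot>\<^bsub>poisson_quot A I\<^esub> x = r \<odot>\<^bsub>alg_quot A I\<^esub> x"
  "\<lbrace>X, Y\<rbrace>\<^bsub>poisson_quot A I\<^esub> = (\<Union>x\<in>X. \<Union>y\<in>Y. I +>\<^bsub>A\<^esub> \<lbrace>x, y\<rbrace>\<^bsub>A\<^esub>)"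
  by (simp_all add: poisson_quot_def module.defs poisson.defs)

lemma (in ideal) coset_eq_iff:
  assumes "x \<in> carrier R" "y \<in> carrier R"
  shows "I +> x = I +> y \<longleftrightarrow> x \<ominus> y \<in> I"
  using quotient_eq_iff_same_a_r_cos[OF is_ideal assms] by blast

lemma (in ideal) mem_coset_iff:
  assumes "x \<in> carrier R"
  shows "y \<in> I +> x \<longleftrightarrow> y \<in> carrier R \<and> I +> y = I +> x"
  using assms a_elemrcos_carrier a_repr_independence' a_rcos_self by metis

lemma (in ideal) zero_coset: "I +> \<zero> = I"
  by (simp add: a_rcos_const)

lemma (in ideal) coset_eq_zero_iff:
  assumes "x \<in> carrier R"
  shows "I +> x = I \<longleftrightarrow> x \<in> I"
  using assms a_rcos_const a_rcos_self by blast

lemma quot_carrier: "carrier (M Quot J) = (\<lambda>x. J +>\<^bsub>M\<^esub> x) ` carrier M"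
  by (auto simp: FactRing_def A_RCOSETS_def')

lemma quot_zero: "\<zero>\<^bsub>M Quot J\<^esub> = J"
  by (simp add: FactRing_def)

text \<open>The scalar action on cosets is well defined because \<open>r x = (r 1) x\<close>: an ideal is automatically
  a submodule.\<close>

lemma coset_alg_hom:
  assumes M: "assoc_algebra R M" and J: "ideal J M"
  shows "(\<lambda>x. J +>\<^bsub>M\<^esub> x) \<in> alg_hom R M (alg_quot M J)"
proof -
  interpret M: assoc_algebra R M by (rule M)
  interpret J: ideal J M by (rule J)
  have hom: "(\<lambda>x. J +>\<^bsub>M\<^esub> x) \<in> ring_hom M (M Quot J)" by (rule J.rcos_ring_hom)
  show ?thesis
  proof (rule alg_homI)
    fix r x assume rx: "r \<in> carrier R" "x \<in> carrier M"
    have "J +>\<^bsub>M\<^esub> (r \<odot>\<^bsub>M\<^esub> x') = J +>\<^bsub>M\<^esub> (r \<odot>\<^bsub>M\<^esub> x)" if "x' \<in> J +>\<^bsub>M\<^esub> x" for x'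
    proof -
      have x': "x' \<in> carrier M" and eq: "J +>\<^bsub>M\<^esub> x' = J +>\<^bsub>M\<^esub> x"
        using that J.mem_coset_iff[OF rx(2)] by simp_all
      have diff: "x' \<ominus>\<^bsub>M\<^esub> x \<in> J"
        using eq J.coset_eq_iff[OF x' rx(2)] by simp
      have "r \<odot>\<^bsub>M\<^esub> x' \<ominus>\<^bsub>M\<^esub> r \<odot>\<^bsub>M\<^esub> x = r \<odot>\<^bsub>M\<^esub> (x' \<ominus>\<^bsub>M\<^esub> x)"
        using rx x' by (simp add: M.minus_eq M.smult_r_distr M.smult_r_minus)
      also have "\<dots> = (r \<odot>\<^bsub>M\<^esub> \<one>\<^bsub>M\<^esub>) \<otimes>\<^bsub>M\<^esub> (x' \<ominus>\<^bsub>M\<^esub> x)"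
        using rx x' by (intro M.smult_eq_mult) auto
      also have "\<dots> \<in> J" using rx diff by (intro J.I_l_closed) auto
      finally show ?thesis using rx x' by (subst J.coset_eq_iff) auto
    qed
    moreover have "x \<in> J +>\<^bsub>M\<^esub> x" using rx by (simp add: J.mem_coset_iff)
    ultimately show "J +>\<^bsub>M\<^esub> (r \<odot>\<^bsub>M\<^esub> x) = r \<odot>\<^bsub>alg_quot M J\<^esub> (J +>\<^bsub>M\<^esub> x)"
      unfolding alg_quot_simps by blast
  qed (use hom in \<open>simp_all add: alg_quot_simps ring_hom_def quot_carrier\<close>)
qed

lemma coset_surj: "(\<lambda>x. J +>\<^bsub>M\<^esub> x) ` carrier M = carrier (alg_quot M J)"
  by (simp add: alg_quot_simps quot_carrier)

lemma assoc_algebra_alg_quot: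
  assumes M: "assoc_algebra R M" and J: "ideal J M"
  shows "assoc_algebra R (alg_quot M J)"
  by (rule assoc_algebra_surj_image[OF M coset_alg_hom[OF M J] _ coset_surj])
    (simp add: alg_quot_simps quot_zero ideal.zero_coset[OF J])

definition poisson_hom ::
    "('r, 'k) ring_scheme \<Rightarrow> ('r, 'a, 'y) poisson_scheme \<Rightarrow> ('r, 'b, 'z) poisson_scheme \<Rightarrow> ('a \<Rightarrow> 'b) set"
  where "poisson_hom R A B = alg_hom R A B \<inter> lie_hom R A (bracket A) B (bracket B)"

lemma poisson_hom_bracket:
  assumes "q \<in> poisson_hom R A B" "x \<in> carrier A" "y \<in> carrier A"
  shows "q \<lbrace>x, y\<rbrace>\<^bsub>A\<^esub> = \<lbrace>q x, q y\<rbrace>\<^bsub>B\<^esub>"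
  using assms by (auto simp: poisson_hom_def lie_hom_def)

lemma (in poisson_algebra) bracket_antisym:
  assumes "x \<in> carrier A" "y \<in> carrier A"
  shows "\<lbrace>y, x\<rbrace>\<^bsub>A\<^esub> = \<ominus>\<^bsub>A\<^esub> \<lbrace>x, y\<rbrace>\<^bsub>A\<^esub>"
proof -
  have "\<lbrace>x \<oplus>\<^bsub>A\<^esub> y, x \<oplus>\<^bsub>A\<^esub> y\<rbrace>\<^bsub>A\<^esub> = \<lbrace>y, x\<rbrace>\<^bsub>A\<^esub> \<oplus>\<^bsub>A\<^esub> \<lbrace>x, y\<rbrace>\<^bsub>A\<^esub>"
    using assms by (simp add: br_add_left br_add_right br_closed)
      (simp add: br_alternating br_closed a_comm)
  then show ?thesis
    using assms by (metis M.add.inv_equality M.add.m_closed br_alternating br_closed)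
qed

lemma (in poisson_ideal) lie_ideal_right: "\<lbrakk>i \<in> I; x \<in> carrier A\<rbrakk> \<Longrightarrow> \<lbrace>x, i\<rbrace>\<^bsub>A\<^esub> \<in> I"
  using lie_ideal bracket_antisym by (metis Icarr M.add.inv_closed m_inv_closed a_inv_def)

text \<open>The bracket of two cosets does not depend on representatives: for \<open>i, j \<in> I\<close> the difference
  \<open>{i + x, j + y} - {x, y}\<close> is \<open>{i, j + y} + {x, j}\<close>, and \<open>I\<close> is a Lie ideal on both sides.\<close>

lemma (in poisson_ideal) coset_poisson_hom: "quot_map A I \<in> poisson_hom R A (poisson_quot A I)"
proof -
  have id: "ideal I A" by (rule is_ideal)
  have "quot_map A I \<in> alg_hom R A (alg_quot A I)"
    by (rule coset_alg_hom[OF algebra_imp_assoc_algebra id])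
  then have alg: "quot_map A I \<in> alg_hom R A (poisson_quot A I)"
    by (simp add: alg_hom_def linear_maps_def ring_hom_def poisson_quot_simps)
  have "I +>\<^bsub>A\<^esub> \<lbrace>x, y\<rbrace>\<^bsub>A\<^esub> = \<lbrace>I +>\<^bsub>A\<^esub> x, I +>\<^bsub>A\<^esub> y\<rbrace>\<^bsub>poisson_quot A I\<^esub>"
    if xy: "x \<in> carrier A" "y \<in> carrier A" for x y
  proof -
    have "I +>\<^bsub>A\<^esub> \<lbrace>x', y'\<rbrace>\<^bsub>A\<^esub> = I +>\<^bsub>A\<^esub> \<lbrace>x, y\<rbrace>\<^bsub>A\<^esub>" if mem: "x' \<in> I +>\<^bsub>A\<^esub> x" "y' \<in> I +>\<^bsub>A\<^esub> y" for x' y'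
    proof -
      obtain i where i: "i \<in> I" "x' = i \<oplus>\<^bsub>A\<^esub> x"
        using mem(1) by (auto simp: a_r_coset_def')
      obtain j where j: "j \<in> I" "y' = j \<oplus>\<^bsub>A\<^esub> y"
        using mem(2) by (auto simp: a_r_coset_def')
      note ij = i j
      have [simp]: "i \<in> carrier A" "j \<in> carrier A" using ij Icarr by auto
      have "\<lbrace>x', y'\<rbrace>\<^bsub>A\<^esub> \<ominus>\<^bsub>A\<^esub> \<lbrace>x, y\<rbrace>\<^bsub>A\<^esub> = \<lbrace>i, j \<oplus>\<^bsub>A\<^esub> y\<rbrace>\<^bsub>A\<^esub> \<oplus>\<^bsub>A\<^esub> \<lbrace>x, j\<rbrace>\<^bsub>A\<^esub>"
        using ij xy by (simp add: br_add_left br_add_right br_closed M.a_ac M.minus_eq M.r_neg)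
      also have "\<dots> \<in> I"
        using ij xy by (simp add: lie_ideal lie_ideal_right a_closed)
      finally show ?thesis
        using ij xy by (subst coset_eq_iff) (simp_all add: br_closed)
    qed
    moreover have "x \<in> I +>\<^bsub>A\<^esub> x" "y \<in> I +>\<^bsub>A\<^esub> y" using xy by (simp_all add: mem_coset_iff)
    ultimately show ?thesis
      unfolding poisson_quot_simps by blast
  qed
  then show ?thesis
    using alg by (auto simp: poisson_hom_def alg_hom_def lie_hom_def)
qed

lemma (in poisson_ideal) coset_poisson_surj: "quot_map A I ` carrier A = carrier (poisson_quot A I)"
  by (simp add: poisson_quot_simps coset_surj)

lemma (in poisson_ideal) poisson_algebra_quot: "poisson_algebra R (poisson_quot A I)"
proof (rule poisson_algebra_surj_image[OF poisson_algebra_axioms _ _ _ coset_poisson_surj])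
  show "quot_map A I \<zero>\<^bsub>A\<^esub> = \<zero>\<^bsub>poisson_quot A I\<^esub>"
    by (simp add: poisson_quot_simps alg_quot_simps quot_zero zero_coset)
  show "quot_map A I \<in> alg_hom R A (poisson_quot A I)"
    using coset_poisson_hom by (simp add: poisson_hom_def)
qed (rule poisson_hom_bracket[OF coset_poisson_hom])

section \<open>Poisson pairs along morphisms\<close>

text \<open>A pair of maps satisfying the two identities of an enveloping algebra can be pushed forward
  along a morphism of algebras, pulled back along a morphism of Poisson algebras, and pushed down
  along a surjective one, provided that both maps factor through it.\<close>

lemma poisson_pair_push:
  assumes pair: "poisson_pair R A U \<alpha> \<beta>" and E: "assoc_algebra R E" and p: "p \<in> alg_hom R U E"
  shows "poisson_pair R A E (\<lambda>a. p (\<alpha> a)) (\<lambda>a. p (\<beta> a))"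
proof -
  interpret P: poisson_pair R A U \<alpha> \<beta> by (rule pair)
  interpret E: assoc_algebra R E by (rule E)
  note a = alg_homD[OF P.alpha_hom] and b = lie_homD[OF P.beta_hom]
    and minus = alg_hom_minus[OF p P.U.ring_axioms E.ring_axioms] and p' = alg_homD[OF p]
  show ?thesis
  proof
    show "(\<lambda>a. p (\<alpha> a)) \<in> alg_hom R A E" by (rule alg_hom_comp[OF P.alpha_hom p])
    show "(\<lambda>a. p (\<beta> a)) \<in> lie_hom R A (bracket A) E (commutator E)"
      by (rule lie_homI) (simp_all add: a b minus p' commutator_def)
  qed (simp_all add: a b minus p' P.alpha_bracket P.beta_mult)
qed

lemma poisson_pair_pull:
  assumes A: "poisson_algebra R A" and q: "q \<in> poisson_hom R A B" and pair: "poisson_pair R B E \<alpha> \<beta>"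
  shows "poisson_pair R A E (\<lambda>a. \<alpha> (q a)) (\<lambda>a. \<beta> (q a))"
proof -
  interpret A: poisson_algebra R A by (rule A)
  interpret P: poisson_pair R B E \<alpha> \<beta> by (rule pair)
  have q1: "q \<in> alg_hom R A B" using q by (simp add: poisson_hom_def)
  note a = alg_homD[OF P.alpha_hom] and b = lie_homD[OF P.beta_hom] and q' = alg_homD[OF q1]
    and br = poisson_hom_bracket[OF q]
  show ?thesis
  proof
    show "(\<lambda>a. \<alpha> (q a)) \<in> alg_hom R A E" by (rule alg_hom_comp[OF q1 P.alpha_hom])
    show "(\<lambda>a. \<beta> (q a)) \<in> lie_hom R A (bracket A) E (commutator E)"
      by (rule lie_homI) (simp_all add: b q' br)
  qed (simp_all add: a b q' br P.alpha_bracket P.beta_mult)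
qed

lemma poisson_pair_descend:
  assumes B: "poisson_algebra R B" and q: "q \<in> poisson_hom R A B" and surj: "q ` carrier A = carrier B"
    and pair: "poisson_pair R A E \<alpha> \<beta>"
    and \<alpha>': "\<And>a. a \<in> carrier A \<Longrightarrow> \<alpha>' (q a) = \<alpha> a" and \<beta>': "\<And>a. a \<in> carrier A \<Longrightarrow> \<beta>' (q a) = \<beta> a"
  shows "poisson_pair R B E \<alpha>' \<beta>'"
proof -
  interpret B: poisson_algebra R B by (rule B)
  interpret P: poisson_pair R A E \<alpha> \<beta> by (rule pair)
  have q1: "q \<in> alg_hom R A B" using q by (simp add: poisson_hom_def)
  have lift: "\<And>x. x \<in> carrier B \<Longrightarrow> \<exists>a \<in> carrier A. x = q a" using surj by blast
  note a = alg_homD[OF P.alpha_hom] and b = lie_homD[OF P.beta_hom]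
    and q' = alg_homD(2-5)[OF q1, symmetric] poisson_hom_bracket[OF q, symmetric]
  note h = a b q' \<alpha>' \<beta>' P.br_closed
  show ?thesis
  proof
    show "\<alpha>' \<in> alg_hom R B E" by (rule alg_homI) (auto dest!: lift simp: h)
    show "\<beta>' \<in> lie_hom R B (bracket B) E (commutator E)"
      by (rule lie_homI) (auto dest!: lift simp: h)
  qed (auto dest!: lift simp: h P.alpha_bracket P.beta_mult)
qed

section \<open>The enveloping algebra of a quotient, abstractly\<close>

lemma alg_hom_factor:
  assumes U: "ring U" and E: "ring E" and V: "ring V"
    and p: "p \<in> alg_hom R U E" and surj: "p ` carrier U = carrier E"
    and g: "g \<in> alg_hom R U V"
    and smult: "\<And>r u. \<lbrakk>r \<in> carrier R; u \<in> carrier U\<rbrakk> \<Longrightarrow> r \<odot>\<^bsub>U\<^esub> u \<in> carrier U"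
    and ker: "\<And>u. \<lbrakk>u \<in> carrier U; p u = \<zero>\<^bsub>E\<^esub>\<rbrakk> \<Longrightarrow> g u = \<zero>\<^bsub>V\<^esub>"
  obtains h where "h \<in> alg_hom R E V" "h \<in> extensional (carrier E)"
    "\<And>u. u \<in> carrier U \<Longrightarrow> h (p u) = g u"
proof -
  interpret U: ring U by (rule U)
  interpret E: ring E by (rule E)
  interpret V: ring V by (rule V)
  define s where "s x = (SOME u. u \<in> carrier U \<and> p u = x)" for x
  define h where "h = (\<lambda>x \<in> carrier E. g (s x))"
  have hp: "h (p u) = g u" if u: "u \<in> carrier U" for u
  proof -
    have s: "s (p u) \<in> carrier U" "p (s (p u)) = p u"
      unfolding s_def using someI[of "\<lambda>v. v \<in> carrier U \<and> p v = p u" u] u by auto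
    have "p (s (p u) \<ominus>\<^bsub>U\<^esub> u) = \<zero>\<^bsub>E\<^esub>"
      using s u by (simp add: alg_hom_minus[OF p U E] alg_homD(1)[OF p])
    then have "g (s (p u) \<ominus>\<^bsub>U\<^esub> u) = \<zero>\<^bsub>V\<^esub>" using ker s u by simp
    then have "g (s (p u)) = g u"
      using s u by (simp add: alg_hom_minus[OF g U V] alg_homD(1)[OF g] flip: V.r_right_minus_eq)
    then show ?thesis using u by (simp add: h_def alg_homD(1)[OF p])
  qed
  have lift: "\<And>x. x \<in> carrier E \<Longrightarrow> \<exists>u \<in> carrier U. x = p u" using surj by blast
  have "h \<in> alg_hom R E V"
    by (rule alg_homI)
      (auto dest!: lift simp: hp smult alg_homD[OF g] simp flip: alg_homD(2-5)[OF p])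
  then show ?thesis using that hp by (simp add: h_def)
qed

text \<open>Let \<open>q\<close> map \<open>A\<close> onto \<open>B\<close> and \<open>p\<close> map \<open>U(A)\<close> onto \<open>E\<close>, and let \<open>(p \<alpha>, p \<beta>)\<close> descend to a pair
  \<open>(\<alpha>', \<beta>')\<close> on \<open>B\<close>. A pair on \<open>B\<close> with values in a test algebra \<open>V\<close>, composed with \<open>q\<close>, is a pair on \<open>A\<close>
  and induces a morphism \<open>g\<close> from \<open>U(A)\<close> to \<open>V\<close> that vanishes on \<open>\<alpha> (ker q)\<close> and \<open>\<beta> (ker q)\<close>. The
  hypothesis \<open>minimal\<close> says that the kernel of \<open>p\<close> is as small as it can be, so that every such
  \<open>g\<close> vanishes on it. Then \<open>g\<close> factors through \<open>p\<close>, and the factor is the only solution since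
  \<open>p\<close> is onto.\<close>

theorem poisson_enveloping_quotient:
  fixes E :: "('r, 'e, 'z) module_scheme"
  assumes env: "poisson_enveloping TYPE('d) R A U \<alpha> \<beta>"
    and B: "poisson_algebra R B" and q: "q \<in> poisson_hom R A B" and q_surj: "q ` carrier A = carrier B"
    and E: "assoc_algebra R E" and p: "p \<in> alg_hom R U E" and p_surj: "p ` carrier U = carrier E"
    and \<alpha>': "\<And>a. a \<in> carrier A \<Longrightarrow> \<alpha>' (q a) = p (\<alpha> a)"
    and \<beta>': "\<And>a. a \<in> carrier A \<Longrightarrow> \<beta>' (q a) = p (\<beta> a)"
    and minimal: "\<And>(V :: ('r, 'd) module) g u. \<lbrakk>assoc_algebra R V; g \<in> alg_hom R U V;
        \<And>a. \<lbrakk>a \<in> carrier A; q a = \<zero>\<^bsub>B\<^esub>\<rbrakk> \<Longrightarrow> g (\<alpha> a) = \<zero>\<^bsub>V\<^esub> \<and> g (\<beta> a) = \<zero>\<^bsub>V\<^esub>;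
        u \<in> carrier U; p u = \<zero>\<^bsub>E\<^esub>\<rbrakk> \<Longrightarrow> g u = \<zero>\<^bsub>V\<^esub>"
  shows "poisson_enveloping TYPE('d) R B E \<alpha>' \<beta>'"
proof -
  have pair: "poisson_pair R A U \<alpha> \<beta>" using env by (simp add: poisson_enveloping_def)
  interpret P: poisson_pair R A U \<alpha> \<beta> by (rule pair)
  interpret B: poisson_algebra R B by (rule B)
  interpret E: assoc_algebra R E by (rule E)
  have pairE: "poisson_pair R B E \<alpha>' \<beta>'"
    by (rule poisson_pair_descend[OF B q q_surj poisson_pair_push[OF pair E p]]) (simp_all add: \<alpha>' \<beta>')
  have lift: "\<And>x. x \<in> carrier B \<Longrightarrow> \<exists>a \<in> carrier A. x = q a" using q_surj by blast
  have liftE: "\<And>x. x \<in> carrier E \<Longrightarrow> \<exists>u \<in> carrier U. x = p u" using p_surj by blast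
  have qc: "\<And>a. a \<in> carrier A \<Longrightarrow> q a \<in> carrier B" using q_surj by blast
  have "\<exists>!h. h \<in> alg_hom R E V \<and> h \<in> extensional (carrier E) \<and>
      (\<forall>b \<in> carrier B. h (\<alpha>' b) = a' b \<and> h (\<beta>' b) = b' b)"
    if V: "poisson_pair R B V a' b'" for V :: "('r, 'd) module" and a' b'
  proof -
    interpret V: poisson_pair R B V a' b' by (rule V)
    have Va: "assoc_algebra R V" by (rule V.U.assoc_algebra_axioms)
    have pullback: "poisson_pair R A V (\<lambda>a. a' (q a)) (\<lambda>a. b' (q a))"
      by (rule poisson_pair_pull[OF P.poisson_algebra_axioms q V])
    then have unique: "\<exists>!g. g \<in> alg_hom R U V \<and> g \<in> extensional (carrier U) \<and>
        (\<forall>a \<in> carrier A. g (\<alpha> a) = a' (q a) \<and> g (\<beta> a) = b' (q a))"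
      using env by (simp add: poisson_enveloping_def)
    then obtain g where g: "g \<in> alg_hom R U V"
      and g_ext: "\<And>a. a \<in> carrier A \<Longrightarrow> g (\<alpha> a) = a' (q a)" "\<And>a. a \<in> carrier A \<Longrightarrow> g (\<beta> a) = b' (q a)"
      by blast
    have a'0: "a' \<zero>\<^bsub>B\<^esub> = \<zero>\<^bsub>V\<^esub>"
      by (rule alg_hom_zero[OF V.alpha_hom B.ring_axioms V.U.ring_axioms])
    have b'0: "b' \<zero>\<^bsub>B\<^esub> = \<zero>\<^bsub>V\<^esub>"
      using lie_homD(3)[OF V.beta_hom cring.cring_simprules(2)[OF B.R_cring] B.zero_closed]
        lie_homD(1)[OF V.beta_hom B.zero_closed]
      by (simp add: module.smult_l_null[OF B.module] module.smult_l_null[OF V.U.module_axioms] B.zero_closed)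
    have ker: "g u = \<zero>\<^bsub>V\<^esub>" if "u \<in> carrier U" "p u = \<zero>\<^bsub>E\<^esub>" for u
      using minimal[OF Va g _ that] by (simp add: g_ext a'0 b'0)
    obtain h where h: "h \<in> alg_hom R E V" "h \<in> extensional (carrier E)"
      and hp: "\<And>u. u \<in> carrier U \<Longrightarrow> h (p u) = g u"
      by (rule alg_hom_factor[OF P.U.ring_axioms E.ring_axioms V.U.ring_axioms p p_surj g _ ker]) auto
    show ?thesis
    proof (intro ex1I conjI ballI)
      fix b assume "b \<in> carrier B"
      then obtain a where a: "a \<in> carrier A" "b = q a" using lift by blast
      show "h (\<alpha>' b) = a' b" "h (\<beta>' b) = b' b"
        using a by (simp_all add: \<alpha>' \<beta>' hp g_ext alg_homD(1)[OF P.alpha_hom] lie_homD(1)[OF P.beta_hom])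
    next
      fix k assume k: "k \<in> alg_hom R E V \<and> k \<in> extensional (carrier E) \<and>
        (\<forall>b \<in> carrier B. k (\<alpha>' b) = a' b \<and> k (\<beta>' b) = b' b)"
      \<comment> \<open>Both solutions, composed with \<open>p\<close> and cut down to the carrier of \<open>U\<close>, solve the problem that
        has \<open>g\<close> as its unique solution.\<close>
      define res where "res f = (\<lambda>u \<in> carrier U. f (p u))" for f :: "'e \<Rightarrow> 'd"
      have res: "res f \<in> alg_hom R U V \<and> res f \<in> extensional (carrier U) \<and>
          (\<forall>a \<in> carrier A. res f (\<alpha> a) = a' (q a) \<and> res f (\<beta> a) = b' (q a))"
        if "f \<in> alg_hom R E V" "\<And>b. b \<in> carrier B \<Longrightarrow> f (\<alpha>' b) = a' b"
          "\<And>b. b \<in> carrier B \<Longrightarrow> f (\<beta>' b) = b' b" for f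
      proof -
        have "res f \<in> alg_hom R U V"
          by (rule alg_homI) (simp_all add: res_def alg_homD[OF p] alg_homD[OF that(1)])
        moreover have "f (p (\<alpha> a)) = a' (q a)" "f (p (\<beta> a)) = b' (q a)" if "a \<in> carrier A" for a
          using that \<open>\<And>b. b \<in> carrier B \<Longrightarrow> f (\<alpha>' b) = a' b\<close> \<open>\<And>b. b \<in> carrier B \<Longrightarrow> f (\<beta>' b) = b' b\<close>
          by (simp_all add: qc flip: \<alpha>' \<beta>')
        ultimately show ?thesis
          by (simp add: res_def alg_homD(1)[OF P.alpha_hom] lie_homD(1)[OF P.beta_hom])
      qed
      have "h (\<alpha>' b) = a' b" "h (\<beta>' b) = b' b" if "b \<in> carrier B" for b
        using lift[OF that] by (auto simp: \<alpha>' \<beta>' hp g_ext alg_homD(1)[OF P.alpha_hom] lie_homD(1)[OF P.beta_hom])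
      then have "res k = res h"
        using unique res[of k] res[of h] k h(1) by blast
      then have "k (p u) = h (p u)" if "u \<in> carrier U" for u
        using that unfolding res_def by (metis restrict_apply')
      then show "k = h"
        using k h(2) liftE by (intro extensionalityI[of _ "carrier E"]) auto
    qed (use h in auto)
  qed
  then show ?thesis
    unfolding poisson_enveloping_def using pairE by blast
qed

section \<open>Tensor products\<close>

locale tensor_factors = Module.module S M + N: Module.module S N
  for S :: "('s, 'k) ring_scheme" (structure) and M :: "('s, 'm, 'y) module_scheme"
    and N :: "('s, 'n, 'z) module_scheme"
begin

abbreviation "F \<equiv> formal_tensors M N"
abbreviation "K \<equiv> tensor_kernel S M N"
abbreviation "T \<equiv> tensor_group S M N"
abbreviation tens (infixl \<open>\<otimes>t\<close> 72) where "m \<otimes>t n \<equiv> tensor S M N m n"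

lemma relations_subset: "tensor_relations S M N \<subseteq> carrier F"
proof
  fix x assume "x \<in> tensor_relations S M N"
  then show "x \<in> carrier F"
    by (auto simp: tensor_relations_def formal_tensors_def dest!: subsetD[OF keys_diff])
qed

lemma comm_group_formal_tensors: "comm_group F"
  by (simp add: formal_tensors_def abelian_free_Abelian_group)

lemma group_formal_tensors: "Group.group F"
  by (simp add: formal_tensors_def)

lemma kernel_subgroup: "subgroup K F"
  unfolding tensor_kernel_def
  by (rule group.generate_is_subgroup[OF group_formal_tensors relations_subset])

lemma kernel_normal: "K \<lhd> F"
  by (rule comm_group.subgroup_imp_normal[OF comm_group_formal_tensors kernel_subgroup])

lemma comm_group_tensor_group: "comm_group T"
  unfolding tensor_group_def
  by (rule comm_group.abelian_FactGroup[OF comm_group_formal_tensors kernel_subgroup])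

lemma coset_hom: "(\<lambda>x. K #>\<^bsub>F\<^esub> x) \<in> hom F T"
  unfolding tensor_group_def by (rule normal.r_coset_hom_Mod[OF kernel_normal])

lemma coset_add:
  assumes "x \<in> carrier F" "y \<in> carrier F"
  shows "K #>\<^bsub>F\<^esub> (x + y) = (K #>\<^bsub>F\<^esub> x) \<otimes>\<^bsub>T\<^esub> (K #>\<^bsub>F\<^esub> y)"
  using hom_mult[OF coset_hom assms] by (simp add: formal_tensors_def)

lemma coset_eqI:
  assumes "x \<in> carrier F" "y \<in> carrier F" "x - y \<in> K"
  shows "K #>\<^bsub>F\<^esub> x = K #>\<^bsub>F\<^esub> y"
proof -
  have "x \<in> K #>\<^bsub>F\<^esub> y"
    unfolding r_coset_def using assms(3)
    by (auto simp: formal_tensors_def intro!: bexI[of _ "x - y"])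
  then show ?thesis
    using group.repr_independence[OF group_formal_tensors _ assms(2) kernel_subgroup] by simp
qed

lemma frag_of_formal: "\<lbrakk>m \<in> carrier M; n \<in> carrier N\<rbrakk> \<Longrightarrow> frag_of (m, n) \<in> carrier F"
  by (simp add: formal_tensors_def)

lemma formal_add: "\<lbrakk>x \<in> carrier F; y \<in> carrier F\<rbrakk> \<Longrightarrow> x + y \<in> carrier F"
  using group.is_monoid[OF group_formal_tensors] monoid.m_closed[of F x y]
  by (simp add: formal_tensors_def)

lemma relation_in_kernel: "x \<in> tensor_relations S M N \<Longrightarrow> x \<in> K"
  by (simp add: tensor_kernel_def generate.incl)

lemma tensor_closed: "\<lbrakk>m \<in> carrier M; n \<in> carrier N\<rbrakk> \<Longrightarrow> m \<otimes>t n \<in> carrier T"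
  unfolding tensor_def using hom_in_carrier[OF coset_hom frag_of_formal] .

lemma tensor_add_left:
  assumes "m \<in> carrier M" "m' \<in> carrier M" "n \<in> carrier N"
  shows "(m \<oplus>\<^bsub>M\<^esub> m') \<otimes>t n = (m \<otimes>t n) \<otimes>\<^bsub>T\<^esub> (m' \<otimes>t n)"
proof -
  have "frag_of (m \<oplus>\<^bsub>M\<^esub> m', n) - (frag_of (m, n) + frag_of (m', n)) \<in> K"
    using assms unfolding diff_diff_eq[symmetric]
    by (intro relation_in_kernel) (auto simp: tensor_relations_def)
  then show ?thesis
    unfolding tensor_def using assms
    by (subst coset_add[symmetric]) (simp_all add: coset_eqI formal_add frag_of_formal)
qed

lemma tensor_add_right:
  assumes "m \<in> carrier M" "n \<in> carrier N" "n' \<in> carrier N"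
  shows "m \<otimes>t (n \<oplus>\<^bsub>N\<^esub> n') = (m \<otimes>t n) \<otimes>\<^bsub>T\<^esub> (m \<otimes>t n')"
proof -
  have "frag_of (m, n \<oplus>\<^bsub>N\<^esub> n') - (frag_of (m, n) + frag_of (m, n')) \<in> K"
    using assms unfolding diff_diff_eq[symmetric]
    by (intro relation_in_kernel) (auto simp: tensor_relations_def)
  then show ?thesis
    unfolding tensor_def using assms
    by (subst coset_add[symmetric]) (simp_all add: coset_eqI formal_add frag_of_formal)
qed

lemma tensor_balanced:
  assumes "s \<in> carrier S" "m \<in> carrier M" "n \<in> carrier N"
  shows "(s \<odot>\<^bsub>M\<^esub> m) \<otimes>t n = m \<otimes>t (s \<odot>\<^bsub>N\<^esub> n)"
proof -
  have "frag_of (s \<odot>\<^bsub>M\<^esub> m, n) - frag_of (m, s \<odot>\<^bsub>N\<^esub> n) \<in> K"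
    using assms by (intro relation_in_kernel) (auto simp: tensor_relations_def)
  then show ?thesis
    unfolding tensor_def using assms by (simp add: coset_eqI frag_of_formal)
qed

text \<open>The pure tensors generate the tensor product, since formal sums are generated by their
  symbols.\<close>

lemma tensor_group_subgroup_eq:
  assumes H: "subgroup H T" and pure: "\<And>m n. \<lbrakk>m \<in> carrier M; n \<in> carrier N\<rbrakk> \<Longrightarrow> m \<otimes>t n \<in> H"
  shows "H = carrier T"
proof
  show "H \<subseteq> carrier T" by (rule subgroup.subset[OF H])
  interpret T: comm_group T by (rule comm_group_tensor_group)
  interpret c: group_hom F T "\<lambda>x. K #>\<^bsub>F\<^esub> x"
    using group_formal_tensors coset_hom T.is_group by (simp add: group_hom_def group_hom_axioms_def)
  show "carrier T \<subseteq> H"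
  proof
    fix X assume "X \<in> carrier T"
    then obtain x where x: "Poly_Mapping.keys x \<subseteq> carrier M \<times> carrier N" and X: "X = K #>\<^bsub>F\<^esub> x"
      by (auto simp: tensor_group_def carrier_FactGroup formal_tensors_def)
    have "K #>\<^bsub>F\<^esub> x \<in> H"
    proof (rule free_Abelian_group_induct[OF x])
      show "K #>\<^bsub>F\<^esub> 0 \<in> H"
        using c.hom_one subgroup.one_closed[OF H] by (simp add: formal_tensors_def)
      show "K #>\<^bsub>F\<^esub> frag_of a \<in> H" if "a \<in> carrier M \<times> carrier N" for a
        using that pure by (auto simp: tensor_def)
    next
      fix x y :: "'m \<times> 'n \<Rightarrow>\<^sub>0 int"
      assume xy: "Poly_Mapping.keys x \<subseteq> carrier M \<times> carrier N" "Poly_Mapping.keys y \<subseteq> carrier M \<times> carrier N"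
        "K #>\<^bsub>F\<^esub> x \<in> H" "K #>\<^bsub>F\<^esub> y \<in> H"
      have F: "x \<in> carrier F" "y \<in> carrier F" "x - y = x \<otimes>\<^bsub>F\<^esub> inv\<^bsub>F\<^esub> y"
        using xy by (simp_all add: formal_tensors_def)
      show "K #>\<^bsub>F\<^esub> (x - y) \<in> H"
        unfolding F(3) using F(1,2) xy(3,4) H
        by (simp add: subgroup.m_closed subgroup.m_inv_closed)
    qed
    then show "X \<in> H" by (simp add: X)
  qed
qed

text \<open>A balanced biadditive map extends to formal sums by freeness, and the extension kills the
  generators of the kernel.\<close>

lemma tensor_group_universal:
  assumes G: "comm_group G"
    and closed: "\<And>m n. \<lbrakk>m \<in> carrier M; n \<in> carrier N\<rbrakk> \<Longrightarrow> \<phi> m n \<in> carrier G"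
    and add_left: "\<And>m m' n. \<lbrakk>m \<in> carrier M; m' \<in> carrier M; n \<in> carrier N\<rbrakk> \<Longrightarrow>
      \<phi> (m \<oplus>\<^bsub>M\<^esub> m') n = \<phi> m n \<otimes>\<^bsub>G\<^esub> \<phi> m' n"
    and add_right: "\<And>m n n'. \<lbrakk>m \<in> carrier M; n \<in> carrier N; n' \<in> carrier N\<rbrakk> \<Longrightarrow>
      \<phi> m (n \<oplus>\<^bsub>N\<^esub> n') = \<phi> m n \<otimes>\<^bsub>G\<^esub> \<phi> m n'"
    and balanced: "\<And>s m n. \<lbrakk>s \<in> carrier S; m \<in> carrier M; n \<in> carrier N\<rbrakk> \<Longrightarrow>
      \<phi> (s \<odot>\<^bsub>M\<^esub> m) n = \<phi> m (s \<odot>\<^bsub>N\<^esub> n)"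
  obtains h where "h \<in> hom T G" "\<And>m n. \<lbrakk>m \<in> carrier M; n \<in> carrier N\<rbrakk> \<Longrightarrow> h (m \<otimes>t n) = \<phi> m n"
proof -
  interpret G: comm_group G by (rule G)
  have "(\<lambda>(m, n). \<phi> m n) ` (carrier M \<times> carrier N) \<subseteq> carrier G" using closed by auto
  then obtain g0 where g0: "g0 \<in> hom (free_Abelian_group (carrier M \<times> carrier N)) G"
      "\<And>x. x \<in> carrier M \<times> carrier N \<Longrightarrow> g0 (frag_of x) = (\<lambda>(m, n). \<phi> m n) x"
    using G.free_Abelian_group_universal by metis
  have g_hom: "g0 \<in> hom F G" using g0(1) by (simp add: formal_tensors_def)
  interpret g: group_hom F G g0
    using group_formal_tensors g_hom G.is_group by (simp add: group_hom_def group_hom_axioms_def)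
  have g_frag: "g0 (frag_of (m, n)) = \<phi> m n" if "m \<in> carrier M" "n \<in> carrier N" for m n
    using g0(2)[of "(m, n)"] that by simp
  have g_diff: "g0 (x - y) = g0 x \<otimes>\<^bsub>G\<^esub> inv\<^bsub>G\<^esub> g0 y" if "x \<in> carrier F" "y \<in> carrier F" for x y
  proof -
    have "x - y = x \<otimes>\<^bsub>F\<^esub> inv\<^bsub>F\<^esub> y" using that by (simp add: formal_tensors_def)
    then show ?thesis using that by simp
  qed
  have F_diff: "x - y \<in> carrier F" if "x \<in> carrier F" "y \<in> carrier F" for x y
    using that unfolding formal_tensors_def by (auto dest!: subsetD[OF keys_diff])
  have cancel: "inv\<^bsub>G\<^esub> b \<otimes>\<^bsub>G\<^esub> (inv\<^bsub>G\<^esub> a \<otimes>\<^bsub>G\<^esub> (a \<otimes>\<^bsub>G\<^esub> b)) = \<one>\<^bsub>G\<^esub>" if "a \<in> carrier G" "b \<in> carrier G" for a b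
    using that by (simp flip: G.m_assoc)
  have "tensor_relations S M N \<subseteq> kernel F G g0"
  proof
    fix x assume x: "x \<in> tensor_relations S M N"
    then have "g0 x = \<one>\<^bsub>G\<^esub>"
      unfolding tensor_relations_def
      by (auto simp: g_diff F_diff frag_of_formal g_frag add_left add_right balanced closed G.m_assoc
          G.inv_solve_right' G.m_comm cancel)
    then show "x \<in> kernel F G g0" using x relations_subset by (auto simp: kernel_def)
  qed
  then have K: "K \<subseteq> kernel F G g0"
    unfolding tensor_kernel_def
    by (rule group.generate_subgroup_incl[OF group_formal_tensors _ g.subgroup_kernel])
  have "g0 x = g0 y" if "x \<in> carrier F" "y \<in> carrier F" "K #>\<^bsub>F\<^esub> x = K #>\<^bsub>F\<^esub> y" for x y
  proof -
    have "x \<in> K #>\<^bsub>F\<^esub> y"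
      using group.rcos_self[OF group_formal_tensors that(1) kernel_subgroup] that(3) by simp
    then obtain k where "k \<in> K" "x = k \<otimes>\<^bsub>F\<^esub> y" unfolding r_coset_def by blast
    then show ?thesis using K that by (auto simp: kernel_def)
  qed
  then obtain h where h: "h \<in> hom (F Mod K) G" "\<And>x. x \<in> carrier F \<Longrightarrow> h (K #>\<^bsub>F\<^esub> x) = g0 x"
    using FactGroup_universal[OF g_hom kernel_normal] by metis
  show thesis
  proof
    show "h \<in> hom T G" using h(1) by (simp add: tensor_group_def)
    show "h (m \<otimes>t n) = \<phi> m n" if "m \<in> carrier M" "n \<in> carrier N" for m n
      using that by (simp add: tensor_def h(2) frag_of_formal g_frag)
  qed
qed

text \<open>The endomorphism of formal sums induced by a linear \<open>f\<close> sends each defining relation to a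
  defining relation, hence preserves the kernel and acts on cosets.\<close>

lemma tensor_map_left_tensor:
  assumes f: "f \<in> linear_maps S M M" and mn: "m \<in> carrier M" "n \<in> carrier N"
  shows "tensor_map_left S M N f (m \<otimes>t n) = f m \<otimes>t n"
proof -
  let ?f = "frag_extend (\<lambda>(m, n). frag_of (f m, n))"
  have f': "\<And>m. m \<in> carrier M \<Longrightarrow> f m \<in> carrier M"
    "\<And>m m'. \<lbrakk>m \<in> carrier M; m' \<in> carrier M\<rbrakk> \<Longrightarrow> f (m \<oplus>\<^bsub>M\<^esub> m') = f m \<oplus>\<^bsub>M\<^esub> f m'"
    "\<And>s m. \<lbrakk>s \<in> carrier S; m \<in> carrier M\<rbrakk> \<Longrightarrow> f (s \<odot>\<^bsub>M\<^esub> m) = s \<odot>\<^bsub>M\<^esub> f m"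
    using f by (auto simp: linear_maps_def)
  have rel: "?f x \<in> tensor_relations S M N" if "x \<in> tensor_relations S M N" for x
    using that unfolding tensor_relations_def
    by (elim UnE; clarsimp simp: frag_extend_diff f') (use f' in blast)+
  have K: "?f k \<in> K" if "k \<in> K" for k
    using that unfolding tensor_kernel_def
  proof (induction rule: generate.induct)
    case (inv x)
    then have "?f (- x) = inv\<^bsub>F\<^esub> ?f x" "inv\<^bsub>F\<^esub> x = - x"
      using relations_subset rel[of x] by (auto simp: frag_extend_minus formal_tensors_def)
    then show ?case using generate.inv[OF rel[OF inv]] by simp
  next
    case (eng x y)
    then show ?case using generate.eng[OF eng.IH] by (simp add: frag_extend_add formal_tensors_def)
  next
    case one
    show ?case using generate.one[of F "tensor_relations S M N"] by (simp add: formal_tensors_def)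
  qed (use rel in \<open>auto intro: generate.incl\<close>)
  have frag: "frag_of (m, n) \<in> carrier F" "frag_of (f m, n) \<in> carrier F"
    using mn f' frag_of_formal by auto
  have "K #>\<^bsub>F\<^esub> ?f x = f m \<otimes>t n" if x: "x \<in> m \<otimes>t n" for x
  proof -
    obtain k where k: "k \<in> K" "x = k + frag_of (m, n)"
      using x by (auto simp: tensor_def r_coset_def formal_tensors_def)
    have "k \<in> carrier F" "?f k \<in> carrier F" using k(1) K subgroup.subset[OF kernel_subgroup] by auto
    then show ?thesis
      unfolding tensor_def k(2) frag_extend_add
      using K[OF k(1)] frag by (intro coset_eqI) (auto intro: formal_add)
  qed
  moreover have "frag_of (m, n) \<in> m \<otimes>t n"
    unfolding tensor_def by (rule group.rcos_self[OF group_formal_tensors frag(1) kernel_subgroup])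
  ultimately show ?thesis unfolding tensor_map_left_def by blast
qed

end

lemma module_module_via:
  assumes S: "cring S" and M: "ring M" and f: "f \<in> ring_hom S M"
  shows "Module.module S (module_via f M)"
proof -
  interpret S: cring S by (rule S)
  interpret M: ring M by (rule M)
  note h = ring_hom_closed[OF f] ring_hom_add[OF f] ring_hom_mult[OF f] ring_hom_one[OF f]
  have simps: "carrier (module_via f M) = carrier M" "\<And>x y. x \<oplus>\<^bsub>module_via f M\<^esub> y = x \<oplus>\<^bsub>M\<^esub> y"
    "\<zero>\<^bsub>module_via f M\<^esub> = \<zero>\<^bsub>M\<^esub>" "\<And>s x. s \<odot>\<^bsub>module_via f M\<^esub> x = f s \<otimes>\<^bsub>M\<^esub> x"
    by (simp_all add: module_via_def ring.defs module.defs)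
  show ?thesis
  proof (rule moduleI[OF S])
    show "abelian_group (module_via f M)"
      by (rule abelian_groupI) (auto simp: simps M.a_ac intro!: bexI[of _ "\<ominus>\<^bsub>M\<^esub> _"] M.l_neg)
  qed (simp_all add: simps h M.l_distr M.r_distr M.m_assoc)
qed

section \<open>Enveloping algebras are generated by their structure maps\<close>

lemma subalgebra_assoc_algebra:
  assumes U: "assoc_algebra R U" and S: "subring S U" "submodule S R U"
  shows "assoc_algebra R (U\<lparr>carrier := S\<rparr>)"
proof -
  interpret U: assoc_algebra R U by (rule U)
  have sub: "S \<subseteq> carrier U" by (rule subringE(1)[OF S(1)])
  show ?thesis
  proof (intro assoc_algebra.intro assoc_algebra_axioms.intro)
    show "Module.module R (U\<lparr>carrier := S\<rparr>)"
      by (rule submodule.submodule_is_module[OF S(2) U.module_axioms])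
    show "ring (U\<lparr>carrier := S\<rparr>)" by (rule U.subring_is_ring[OF S(1)])
  qed (use sub in \<open>simp_all add: subset_iff U.smult_mult_left U.smult_mult_right\<close>)
qed

lemma poisson_pair_subalgebra:
  assumes pair: "poisson_pair R A U \<alpha> \<beta>" and S: "subring S U" "submodule S R U"
    and im: "\<alpha> ` carrier A \<subseteq> S" "\<beta> ` carrier A \<subseteq> S"
  shows "poisson_pair R A (U\<lparr>carrier := S\<rparr>) \<alpha> \<beta>"
proof -
  interpret P: poisson_pair R A U \<alpha> \<beta> by (rule pair)
  interpret S: assoc_algebra R "U\<lparr>carrier := S\<rparr>"
    by (rule subalgebra_assoc_algebra[OF P.U.assoc_algebra_axioms S])
  have mult: "\<And>x y. \<lbrakk>x \<in> S; y \<in> S\<rbrakk> \<Longrightarrow> x \<otimes>\<^bsub>U\<^esub> y \<in> S" by (rule subringE(6)[OF S(1)])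
  have minus: "x \<ominus>\<^bsub>U\<lparr>carrier := S\<rparr>\<^esub> y = x \<ominus>\<^bsub>U\<^esub> y" if "x \<in> S" "y \<in> S" for x y
  proof -
    have "subgroup S (add_monoid U)" by (rule submodule.axioms(1)[OF S(2)])
    then have "\<ominus>\<^bsub>U\<lparr>carrier := S\<rparr>\<^esub> y = \<ominus>\<^bsub>U\<^esub> y"
      using P.U.add.m_inv_consistent[of S y] that unfolding a_inv_def by simp
    then show ?thesis by (simp add: a_minus_def)
  qed
  note a = alg_homD[OF P.alpha_hom] and b = lie_homD[OF P.beta_hom]
  have im': "\<And>x. x \<in> carrier A \<Longrightarrow> \<alpha> x \<in> S" "\<And>x. x \<in> carrier A \<Longrightarrow> \<beta> x \<in> S" using im by auto
  show ?thesis
  proof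
    show "\<alpha> \<in> alg_hom R A (U\<lparr>carrier := S\<rparr>)" by (rule alg_homI) (simp_all add: a im')
    show "\<beta> \<in> lie_hom R A (bracket A) (U\<lparr>carrier := S\<rparr>) (commutator (U\<lparr>carrier := S\<rparr>))"
      by (rule lie_homI) (simp_all add: b im' commutator_def minus mult)
  qed (simp_all add: minus mult im' P.alpha_bracket P.beta_mult)
qed

text \<open>If a subalgebra \<open>S\<close> contains both images, the universal property yields a morphism from \<open>U\<close>
  to \<open>S\<close>. Composed with the inclusion it is an endomorphism of \<open>U\<close> fixing \<open>\<alpha>\<close> and \<open>\<beta>\<close>, hence the
  identity by uniqueness. Here the test algebra \<open>S\<close> lives in the type of \<open>U\<close>.\<close>

lemma poisson_enveloping_generated:
  fixes U :: "('r, 'u) module"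
  assumes env: "poisson_enveloping TYPE('u) R A U \<alpha> \<beta>"
    and S: "subring S U" "submodule S R U" and im: "\<alpha> ` carrier A \<subseteq> S" "\<beta> ` carrier A \<subseteq> S"
  shows "S = carrier U"
proof
  let ?S = "U\<lparr>carrier := S\<rparr>"
  have pair: "poisson_pair R A U \<alpha> \<beta>" using env by (simp add: poisson_enveloping_def)
  interpret P: poisson_pair R A U \<alpha> \<beta> by (rule pair)
  show sub: "S \<subseteq> carrier U" by (rule subringE(1)[OF S(1)])
  have univ: "poisson_pair R A V a b \<Longrightarrow> \<exists>!\<gamma>. \<gamma> \<in> alg_hom R U V \<and> \<gamma> \<in> extensional (carrier U) \<and>
      (\<forall>x \<in> carrier A. \<gamma> (\<alpha> x) = a x \<and> \<gamma> (\<beta> x) = b x)" for V :: "('r, 'u) module" and a b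
    using env unfolding poisson_enveloping_def by blast
  obtain g where g: "g \<in> alg_hom R U ?S" "g \<in> extensional (carrier U)"
      "\<And>x. x \<in> carrier A \<Longrightarrow> g (\<alpha> x) = \<alpha> x" "\<And>x. x \<in> carrier A \<Longrightarrow> g (\<beta> x) = \<beta> x"
    using univ[OF poisson_pair_subalgebra[OF pair S im]] by blast
  have "g \<in> alg_hom R U U"
    using alg_homD[OF g(1)] sub by (intro alg_homI) auto
  moreover have "restrict id (carrier U) \<in> alg_hom R U U"
    by (rule alg_homI) auto
  ultimately have "g = restrict id (carrier U)"
    using univ[OF pair] g alg_homD(1)[OF P.alpha_hom] lie_homD(1)[OF P.beta_hom]
    by (auto elim!: ex1E) (metis (no_types, lifting) id_apply restrict_apply' restrict_extensional)
  then show "carrier U \<subseteq> S" using alg_homD(1)[OF g(1)] by auto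
qed

section \<open>The algebra on the tensor product\<close>

lemma module_via_simps:
  "carrier (module_via f M) = carrier M" "x \<oplus>\<^bsub>module_via f M\<^esub> y = x \<oplus>\<^bsub>M\<^esub> y"
  "\<zero>\<^bsub>module_via f M\<^esub> = \<zero>\<^bsub>M\<^esub>" "s \<odot>\<^bsub>module_via f M\<^esub> z = f s \<otimes>\<^bsub>M\<^esub> z"
  by (simp_all add: module_via_def ring.defs module.defs)

text \<open>The assumption \<open>generated\<close> is the part of the universal property of \<open>U\<close> on which the product on
  the tensor product rests; isolating it keeps the construction independent of the type of the test
  algebras.\<close>

locale poisson_base_change = poisson_ideal R A I + poisson_pair R A U \<alpha> \<beta>
  for R :: "('r, 'k) ring_scheme" (structure) and A :: "('r, 'a, 'y) poisson_scheme" (structure)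
    and I :: "'a set" and U :: "('r, 'u, 'z) module_scheme" (structure)
    and \<alpha> :: "'a \<Rightarrow> 'u" and \<beta> :: "'a \<Rightarrow> 'u" +
  assumes generated: "\<lbrakk>subring S U; submodule S R U; \<alpha> ` carrier A \<subseteq> S; \<beta> ` carrier A \<subseteq> S\<rbrakk> \<Longrightarrow> S = carrier U"
begin

abbreviation "B \<equiv> poisson_quot A I"
abbreviation "\<pi> \<equiv> quot_map A I"
abbreviation "M \<equiv> module_via \<pi> B"
abbreviation "N \<equiv> module_via \<alpha> U"
abbreviation "T \<equiv> tensor_group A M N"
abbreviation "BU \<equiv> bc_algebra A I U \<alpha>"

definition \<tau> :: "'u \<Rightarrow> ('a set \<times> 'u \<Rightarrow>\<^sub>0 int) set"
  where "\<tau> u = tensor A M N \<one>\<^bsub>B\<^esub> u"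

lemma B_poisson: "poisson_algebra R B" by (rule poisson_algebra_quot)

lemma pi_hom: "\<pi> \<in> alg_hom R A B"
  using coset_poisson_hom by (simp add: poisson_hom_def)

lemma B_ring: "ring B"
  using B_poisson by (simp add: poisson_algebra_def algebra_def cring_def)

lemma A_cring: "cring A" by (rule M_cring)

lemma A_ring: "ring A" using A_cring by (rule cring.axioms)

lemma factors: "tensor_factors A M N"
proof -
  have "\<pi> \<in> ring_hom A B" "\<alpha> \<in> ring_hom A U" using pi_hom alpha_hom by (auto simp: alg_hom_def)
  then show ?thesis
    unfolding tensor_factors_def
    using module_module_via[OF A_cring B_ring] module_module_via[OF A_cring U.ring_axioms] by blast
qed

lemmas alpha = alg_homD[OF alpha_hom]
lemmas beta = lie_homD[OF beta_hom]
lemmas pi = alg_homD[OF pi_hom]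

lemma T_group: "comm_group T"
  by (rule tensor_factors.comm_group_tensor_group[OF factors])

lemma pi_lift: "b \<in> carrier B \<Longrightarrow> \<exists>a \<in> carrier A. b = \<pi> a"
  using coset_poisson_surj by blast

lemma pi_zero_iff: "a \<in> carrier A \<Longrightarrow> \<pi> a = \<zero>\<^bsub>B\<^esub> \<longleftrightarrow> a \<in> I"
  by (simp add: poisson_quot_simps alg_quot_simps quot_zero coset_eq_zero_iff)

lemma I_A: "i \<in> I \<Longrightarrow> i \<in> carrier A" by (rule Icarr)

lemma B_one: "\<one>\<^bsub>B\<^esub> \<in> carrier B" using B_ring by (simp add: ring.ring_simprules)

lemma pure_tensor: "\<lbrakk>a \<in> carrier A; u \<in> carrier U\<rbrakk> \<Longrightarrow> tensor A M N (\<pi> a) u = \<tau> (\<alpha> a \<otimes>\<^bsub>U\<^esub> u)"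
  using tensor_factors.tensor_balanced[OF factors, of a "\<one>\<^bsub>B\<^esub>" u]
  by (simp add: \<tau>_def module_via_simps B_one monoid.r_one[OF ring.is_monoid[OF B_ring]] pi(1))

text \<open>Hence the map \<open>\<tau>\<close>, which sends \<open>u\<close> to \<open>1 \<otimes> u\<close>, reaches every pure tensor, and, being additive, the
  whole tensor product.\<close>

lemma tau_closed: "u \<in> carrier U \<Longrightarrow> \<tau> u \<in> carrier T"
  using tensor_factors.tensor_closed[OF factors] by (simp add: \<tau>_def module_via_simps B_one)

lemma tau_add: "\<lbrakk>u \<in> carrier U; v \<in> carrier U\<rbrakk> \<Longrightarrow> \<tau> (u \<oplus>\<^bsub>U\<^esub> v) = \<tau> u \<otimes>\<^bsub>T\<^esub> \<tau> v"
  using tensor_factors.tensor_add_right[OF factors, of "\<one>\<^bsub>B\<^esub>" u v]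
  by (simp add: \<tau>_def module_via_simps B_one)

lemma tau_group_hom: "group_hom (add_monoid U) T \<tau>"
  using T_group U.add.is_group
  by (auto simp: group_hom_def group_hom_axioms_def comm_group_def hom_def tau_closed tau_add)

lemma tau_surj: "\<tau> ` carrier U = carrier T"
proof (rule tensor_factors.tensor_group_subgroup_eq[OF factors])
  show "subgroup (\<tau> ` carrier U) T"
    using group_hom.img_is_subgroup[OF tau_group_hom] by simp
  show "tensor A M N m n \<in> \<tau> ` carrier U" if "m \<in> carrier M" "n \<in> carrier N" for m n
    using that by (auto dest!: pi_lift simp: module_via_simps pure_tensor alpha(1))
qed

lemma tau_alpha_ideal:
  assumes "i \<in> I" "u \<in> carrier U"
  shows "\<tau> (\<alpha> i \<otimes>\<^bsub>U\<^esub> u) = \<one>\<^bsub>T\<^esub>"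
proof -
  interpret T: comm_group T by (rule T_group)
  interpret B: ring B by (rule B_ring)
  have "\<tau> (\<alpha> i \<otimes>\<^bsub>U\<^esub> u) = tensor A M N \<zero>\<^bsub>B\<^esub> u"
    using assms pure_tensor[of i u] pi_zero_iff[of i] I_A by simp
  moreover have "tensor A M N \<zero>\<^bsub>B\<^esub> u = tensor A M N \<zero>\<^bsub>B\<^esub> u \<otimes>\<^bsub>T\<^esub> tensor A M N \<zero>\<^bsub>B\<^esub> u"
    using tensor_factors.tensor_add_left[OF factors, of "\<zero>\<^bsub>B\<^esub>" "\<zero>\<^bsub>B\<^esub>" u] assms by (simp add: module_via_simps)
  moreover have "tensor A M N \<zero>\<^bsub>B\<^esub> u \<in> carrier T"
    using tensor_factors.tensor_closed[OF factors, of "\<zero>\<^bsub>B\<^esub>" u] assms by (simp add: module_via_simps)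
  ultimately show ?thesis using T.l_cancel_one by metis
qed

text \<open>An upper bound for the kernel of \<open>\<tau>\<close>. If an additive map \<open>\<phi>\<close> on \<open>U\<close> kills \<open>\<alpha>(I) U\<close>, then
  \<open>\<phi> (\<alpha> a u)\<close> depends only on \<open>\<pi> a\<close> and \<open>u\<close>, and it is biadditive and balanced in them. So it extends
  to the tensor product, and \<open>\<phi>\<close> factors through \<open>\<tau>\<close>.\<close>

lemma additive_kills_tau_kernel:
  assumes G: "comm_group G"
    and closed: "\<And>u. u \<in> carrier U \<Longrightarrow> \<phi> u \<in> carrier G"
    and add: "\<And>u v. \<lbrakk>u \<in> carrier U; v \<in> carrier U\<rbrakk> \<Longrightarrow> \<phi> (u \<oplus>\<^bsub>U\<^esub> v) = \<phi> u \<otimes>\<^bsub>G\<^esub> \<phi> v"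
    and kills: "\<And>i u. \<lbrakk>i \<in> I; u \<in> carrier U\<rbrakk> \<Longrightarrow> \<phi> (\<alpha> i \<otimes>\<^bsub>U\<^esub> u) = \<one>\<^bsub>G\<^esub>"
    and u: "u \<in> carrier U" "\<tau> u = \<one>\<^bsub>T\<^esub>"
  shows "\<phi> u = \<one>\<^bsub>G\<^esub>"
proof -
  interpret G: comm_group G by (rule G)
  interpret T: comm_group T by (rule T_group)
  define s where "s b = (SOME a. a \<in> carrier A \<and> \<pi> a = b)" for b
  have s: "\<phi> (\<alpha> (s (\<pi> a)) \<otimes>\<^bsub>U\<^esub> v) = \<phi> (\<alpha> a \<otimes>\<^bsub>U\<^esub> v)" if a: "a \<in> carrier A" and v: "v \<in> carrier U" for a v
  proof -
    have s: "s (\<pi> a) \<in> carrier A" "\<pi> (s (\<pi> a)) = \<pi> a"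
      unfolding s_def using someI[of "\<lambda>a'. a' \<in> carrier A \<and> \<pi> a' = \<pi> a" a] a by auto
    then have d: "s (\<pi> a) \<ominus>\<^bsub>A\<^esub> a \<in> I" using a coset_eq_iff by simp
    have "s (\<pi> a) = (s (\<pi> a) \<ominus>\<^bsub>A\<^esub> a) \<oplus>\<^bsub>A\<^esub> a"
      using s a by (simp add: ring.ring_simprules[OF A_ring])
    then have "\<alpha> (s (\<pi> a)) = \<alpha> (s (\<pi> a) \<ominus>\<^bsub>A\<^esub> a) \<oplus>\<^bsub>U\<^esub> \<alpha> a"
      using alpha(2)[OF I_A[OF d] a] by simp
    then show ?thesis
      using d a v I_A[OF d] by (simp add: U.l_distr alpha add kills closed)
  qed
  note [simp] = module_via_simps
  obtain h where h: "h \<in> hom T G"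
    "\<And>b v. \<lbrakk>b \<in> carrier M; v \<in> carrier N\<rbrakk> \<Longrightarrow> h (tensor A M N b v) = \<phi> (\<alpha> (s b) \<otimes>\<^bsub>U\<^esub> v)"
  proof (rule tensor_factors.tensor_group_universal[OF factors G, of "\<lambda>b v. \<phi> (\<alpha> (s b) \<otimes>\<^bsub>U\<^esub> v)"])
    show "\<phi> (\<alpha> (s m) \<otimes>\<^bsub>U\<^esub> n) \<in> carrier G" if "m \<in> carrier M" "n \<in> carrier N" for m n
      using that by (auto dest!: pi_lift simp: s alpha(1) closed)
    show "\<phi> (\<alpha> (s (m \<oplus>\<^bsub>M\<^esub> m')) \<otimes>\<^bsub>U\<^esub> n) = \<phi> (\<alpha> (s m) \<otimes>\<^bsub>U\<^esub> n) \<otimes>\<^bsub>G\<^esub> \<phi> (\<alpha> (s m') \<otimes>\<^bsub>U\<^esub> n)"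
      if "m \<in> carrier M" "m' \<in> carrier M" "n \<in> carrier N" for m m' n
      using that by (auto dest!: pi_lift simp: s alpha U.l_distr add ring.ring_simprules[OF A_ring] simp flip: pi(2))
    show "\<phi> (\<alpha> (s m) \<otimes>\<^bsub>U\<^esub> (n \<oplus>\<^bsub>N\<^esub> n')) = \<phi> (\<alpha> (s m) \<otimes>\<^bsub>U\<^esub> n) \<otimes>\<^bsub>G\<^esub> \<phi> (\<alpha> (s m) \<otimes>\<^bsub>U\<^esub> n')"
      if "m \<in> carrier M" "n \<in> carrier N" "n' \<in> carrier N" for m n n'
      using that by (auto dest!: pi_lift simp: s alpha U.r_distr add)
    show "\<phi> (\<alpha> (s (a \<odot>\<^bsub>M\<^esub> m)) \<otimes>\<^bsub>U\<^esub> n) = \<phi> (\<alpha> (s m) \<otimes>\<^bsub>U\<^esub> (a \<odot>\<^bsub>N\<^esub> n))"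
      if a: "a \<in> carrier A" and "m \<in> carrier M" "n \<in> carrier N" for a m n
    proof -
      obtain c where c: "c \<in> carrier A" "m = \<pi> c" using \<open>m \<in> carrier M\<close> pi_lift by auto
      have "\<alpha> (a \<otimes>\<^bsub>A\<^esub> c) \<otimes>\<^bsub>U\<^esub> n = \<alpha> (c \<otimes>\<^bsub>A\<^esub> a) \<otimes>\<^bsub>U\<^esub> n"
        using a c by (simp add: comm_monoid.m_comm[OF cring.axioms(2)[OF A_cring]])
      then have "\<alpha> (a \<otimes>\<^bsub>A\<^esub> c) \<otimes>\<^bsub>U\<^esub> n = \<alpha> c \<otimes>\<^bsub>U\<^esub> (\<alpha> a \<otimes>\<^bsub>U\<^esub> n)"
        using a c \<open>n \<in> carrier N\<close> by (simp add: alpha U.m_assoc)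
      then show ?thesis
        using a c \<open>n \<in> carrier N\<close> by (simp add: s alpha(1) ring.ring_simprules[OF A_ring] flip: pi(3))
    qed
  qed blast
  have "\<phi> u = h (\<tau> u)"
    using u(1) s[of "\<one>\<^bsub>A\<^esub>" u] h(2)[of "\<one>\<^bsub>B\<^esub>" u]
    by (simp add: \<tau>_def B_one alpha(4) pi(1) ring.ring_simprules[OF A_ring] flip: pi(4))
  then show ?thesis using h(1) u(2) T.is_group G.is_group hom_one by metis
qed

definition tau_kernel where "tau_kernel = {u \<in> carrier U. \<tau> u = \<one>\<^bsub>T\<^esub>}"

lemma tau_kernel_subgroup: "subgroup tau_kernel (add_monoid U)"
  using group_hom.subgroup_kernel[OF tau_group_hom] by (simp add: tau_kernel_def kernel_def)

lemma tau_kernel_carrier: "u \<in> tau_kernel \<Longrightarrow> u \<in> carrier U" by (simp add: tau_kernel_def)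

lemma tau_kernel_zero: "\<zero>\<^bsub>U\<^esub> \<in> tau_kernel" using subgroup.one_closed[OF tau_kernel_subgroup] by simp

lemma tau_kernel_add: "\<lbrakk>u \<in> tau_kernel; v \<in> tau_kernel\<rbrakk> \<Longrightarrow> u \<oplus>\<^bsub>U\<^esub> v \<in> tau_kernel"
  using subgroup.m_closed[OF tau_kernel_subgroup] by simp

lemma tau_kernel_neg: "u \<in> tau_kernel \<Longrightarrow> \<ominus>\<^bsub>U\<^esub> u \<in> tau_kernel"
  using subgroup.m_inv_closed[OF tau_kernel_subgroup] by (simp add: a_inv_def)

lemma alpha_ideal_tau_kernel: "\<lbrakk>i \<in> I; u \<in> carrier U\<rbrakk> \<Longrightarrow> \<alpha> i \<otimes>\<^bsub>U\<^esub> u \<in> tau_kernel"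
  by (simp add: tau_kernel_def tau_alpha_ideal alpha(1) I_A)

text \<open>An additive endomorphism of \<open>U\<close> preserves the kernel of \<open>\<tau>\<close> as soon as it sends \<open>\<alpha>(I) U\<close> into
  it. This is the bound above for its composition with \<open>\<tau>\<close>; one-sided multiplications are
  treated in this way.\<close>

lemma tau_kernel_preserved:
  assumes f: "\<And>u. u \<in> carrier U \<Longrightarrow> f u \<in> carrier U"
    and add: "\<And>u v. \<lbrakk>u \<in> carrier U; v \<in> carrier U\<rbrakk> \<Longrightarrow> f (u \<oplus>\<^bsub>U\<^esub> v) = f u \<oplus>\<^bsub>U\<^esub> f v"
    and kills: "\<And>i u. \<lbrakk>i \<in> I; u \<in> carrier U\<rbrakk> \<Longrightarrow> f (\<alpha> i \<otimes>\<^bsub>U\<^esub> u) \<in> tau_kernel"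
    and u: "u \<in> tau_kernel"
  shows "f u \<in> tau_kernel"
  using additive_kills_tau_kernel[OF T_group, of "\<lambda>u. \<tau> (f u)" u] assms
  by (simp add: tau_kernel_def tau_closed tau_add)

lemma tau_kernel_mult_right: "\<lbrakk>u \<in> tau_kernel; v \<in> carrier U\<rbrakk> \<Longrightarrow> u \<otimes>\<^bsub>U\<^esub> v \<in> tau_kernel"
  by (rule tau_kernel_preserved[of "\<lambda>u. u \<otimes>\<^bsub>U\<^esub> v"])
    (simp_all add: U.l_distr U.m_assoc alpha(1) I_A alpha_ideal_tau_kernel)

lemma tau_kernel_mult_alpha: "\<lbrakk>a \<in> carrier A; u \<in> tau_kernel\<rbrakk> \<Longrightarrow> \<alpha> a \<otimes>\<^bsub>U\<^esub> u \<in> tau_kernel"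
proof (rule tau_kernel_preserved[of "\<lambda>u. \<alpha> a \<otimes>\<^bsub>U\<^esub> u"])
  fix i u assume *: "a \<in> carrier A" "i \<in> I" "u \<in> carrier U"
  have "\<alpha> (a \<otimes>\<^bsub>A\<^esub> i) \<otimes>\<^bsub>U\<^esub> u \<in> tau_kernel" using * by (intro alpha_ideal_tau_kernel I_l_closed)
  then show "\<alpha> a \<otimes>\<^bsub>U\<^esub> (\<alpha> i \<otimes>\<^bsub>U\<^esub> u) \<in> tau_kernel"
    using * by (simp add: alpha I_A U.m_assoc)
qed (simp_all add: alpha(1) U.r_distr)

text \<open>Commuting \<open>\<beta> a\<close> past \<open>\<alpha> i\<close> costs \<open>\<alpha> {i, a}\<close>, and \<open>{i, a}\<close> stays in \<open>I\<close>. So the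
  product on the tensor product owes its existence to \<open>I\<close> being a Lie ideal.\<close>

lemma tau_kernel_mult_beta: "\<lbrakk>a \<in> carrier A; u \<in> tau_kernel\<rbrakk> \<Longrightarrow> \<beta> a \<otimes>\<^bsub>U\<^esub> u \<in> tau_kernel"
proof (rule tau_kernel_preserved[of "\<lambda>u. \<beta> a \<otimes>\<^bsub>U\<^esub> u"])
  fix i u assume *: "a \<in> carrier A" "i \<in> I" "u \<in> carrier U"
  have i: "i \<in> carrier A" using * I_A by simp
  note c = alpha(1)[OF i] beta(1)[OF *(1)] *(3)
  have "\<beta> a \<otimes>\<^bsub>U\<^esub> \<alpha> i = \<alpha> i \<otimes>\<^bsub>U\<^esub> \<beta> a \<oplus>\<^bsub>U\<^esub> \<ominus>\<^bsub>U\<^esub> (\<alpha> \<lbrace>i, a\<rbrace>\<^bsub>A\<^esub>)"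
    unfolding alpha_bracket[OF i *(1)] using c by (simp add: U.minus_eq U.minus_add U.r_neg U.r_neg1 flip: U.a_assoc)
  then have "\<beta> a \<otimes>\<^bsub>U\<^esub> (\<alpha> i \<otimes>\<^bsub>U\<^esub> u) = (\<alpha> i \<otimes>\<^bsub>U\<^esub> \<beta> a \<oplus>\<^bsub>U\<^esub> \<ominus>\<^bsub>U\<^esub> (\<alpha> \<lbrace>i, a\<rbrace>\<^bsub>A\<^esub>)) \<otimes>\<^bsub>U\<^esub> u"
    using c by (simp add: U.m_assoc[symmetric])
  also have "\<dots> = \<alpha> i \<otimes>\<^bsub>U\<^esub> (\<beta> a \<otimes>\<^bsub>U\<^esub> u) \<oplus>\<^bsub>U\<^esub> \<ominus>\<^bsub>U\<^esub> (\<alpha> \<lbrace>i, a\<rbrace>\<^bsub>A\<^esub> \<otimes>\<^bsub>U\<^esub> u)"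
    using c i * by (simp add: U.l_distr U.m_assoc U.l_minus alpha(1) br_closed)
  also have "\<dots> \<in> tau_kernel"
    using c * by (intro tau_kernel_add tau_kernel_neg alpha_ideal_tau_kernel lie_ideal) simp_all
  finally show "\<beta> a \<otimes>\<^bsub>U\<^esub> (\<alpha> i \<otimes>\<^bsub>U\<^esub> u) \<in> tau_kernel" .
qed (simp_all add: beta(1) U.r_distr)

text \<open>The elements whose left multiplication preserves the kernel form a subalgebra, which contains
  the generators \<open>\<alpha> a\<close> and \<open>\<beta> a\<close> of \<open>U\<close>.\<close>

lemma tau_kernel_mult_left:
  assumes v: "v \<in> carrier U" and u: "u \<in> tau_kernel"
  shows "v \<otimes>\<^bsub>U\<^esub> u \<in> tau_kernel"
proof -
  define S where "S = {v \<in> carrier U. \<forall>u \<in> tau_kernel. v \<otimes>\<^bsub>U\<^esub> u \<in> tau_kernel}"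
  have tau_kernel_smult: "r \<odot>\<^bsub>U\<^esub> u \<in> tau_kernel" if "r \<in> carrier R" "u \<in> tau_kernel" for r u
  proof -
    have "r \<odot>\<^bsub>U\<^esub> u = u \<otimes>\<^bsub>U\<^esub> (r \<odot>\<^bsub>U\<^esub> \<one>\<^bsub>U\<^esub>)"
      using that by (simp add: U.smult_mult_right tau_kernel_carrier)
    then show ?thesis using that tau_kernel_mult_right by simp
  qed
  have "S = carrier U"
  proof (rule generated)
    show "subring S U"
      by (rule U.subringI)
        (auto simp: S_def U.l_minus U.l_distr U.m_assoc tau_kernel_carrier intro: tau_kernel_add tau_kernel_neg)
    show "submodule S R U"
      by (rule U.submoduleI)
        (auto simp: S_def U.l_minus U.l_distr U.smult_mult_left tau_kernel_carrier tau_kernel_zero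
          intro: tau_kernel_add tau_kernel_neg tau_kernel_smult)
    show "\<alpha> ` carrier A \<subseteq> S" "\<beta> ` carrier A \<subseteq> S"
      by (auto simp: S_def alpha(1) beta(1) tau_kernel_mult_alpha tau_kernel_mult_beta)
  qed
  then show ?thesis using v u by (auto simp: S_def)
qed

lemma tau_eq_iff: "\<lbrakk>u \<in> carrier U; v \<in> carrier U\<rbrakk> \<Longrightarrow> \<tau> u = \<tau> v \<longleftrightarrow> u \<ominus>\<^bsub>U\<^esub> v \<in> tau_kernel"
proof -
  interpret T: comm_group T by (rule T_group)
  interpret tau: group_hom "add_monoid U" T \<tau> by (rule tau_group_hom)
  assume uv: "u \<in> carrier U" "v \<in> carrier U"
  have "\<tau> (u \<ominus>\<^bsub>U\<^esub> v) = \<tau> u \<otimes>\<^bsub>T\<^esub> inv\<^bsub>T\<^esub> \<tau> v"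
    using uv tau.hom_inv[of v] by (simp add: U.minus_eq tau_add a_inv_def)
  then show ?thesis using uv by (simp add: tau_kernel_def tau_closed T.inv_solve_right' )
qed

text \<open>Together the two multiplication lemmas make the kernel of \<open>\<tau>\<close> a two-sided ideal.\<close>

lemma tau_mult_cong:
  assumes c: "u \<in> carrier U" "v \<in> carrier U" "u' \<in> carrier U" "v' \<in> carrier U"
    and "\<tau> u = \<tau> u'" "\<tau> v = \<tau> v'"
  shows "\<tau> (u \<otimes>\<^bsub>U\<^esub> v) = \<tau> (u' \<otimes>\<^bsub>U\<^esub> v')"
proof -
  have d: "u \<ominus>\<^bsub>U\<^esub> u' \<in> tau_kernel" "v \<ominus>\<^bsub>U\<^esub> v' \<in> tau_kernel" using assms tau_eq_iff by auto
  have "\<tau> (u \<otimes>\<^bsub>U\<^esub> v) = \<tau> (u' \<otimes>\<^bsub>U\<^esub> v)"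
    using tau_kernel_mult_right[OF d(1) c(2)] c by (subst tau_eq_iff) (simp_all add: U.minus_eq U.l_distr U.l_minus)
  also have "\<dots> = \<tau> (u' \<otimes>\<^bsub>U\<^esub> v')"
    using tau_kernel_mult_left[OF c(3) d(2)] c by (subst tau_eq_iff) (simp_all add: U.minus_eq U.r_distr U.r_minus)
  finally show ?thesis .
qed

lemma bc_algebra_simps:
  "carrier BU = carrier T" "\<one>\<^bsub>BU\<^esub> = \<tau> \<one>\<^bsub>U\<^esub>" "\<zero>\<^bsub>BU\<^esub> = \<one>\<^bsub>T\<^esub>" "x \<oplus>\<^bsub>BU\<^esub> y = x \<otimes>\<^bsub>T\<^esub> y"
  "r \<odot>\<^bsub>BU\<^esub> x = tensor_map_left A M N (\<lambda>b. r \<odot>\<^bsub>B\<^esub> b) x"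
  "bc_tensor A I U \<alpha> \<one>\<^bsub>B\<^esub> u = \<tau> u"
  by (simp_all add: bc_algebra_def bc_tensor_def \<tau>_def Let_def)

text \<open>The definite description in the product has a value: \<open>a\<^sub>1 = a\<^sub>2 = 1\<close> witnesses existence, and
  uniqueness is the congruence just shown, since \<open>\<pi>(a\<^sub>i) \<otimes> u\<^sub>i\<close> is the image under \<open>\<tau>\<close> of \<open>\<alpha>(a\<^sub>i) u\<^sub>i\<close>.\<close>

lemma bc_algebra_mult:
  assumes uv: "u \<in> carrier U" "v \<in> carrier U"
  shows "\<tau> u \<otimes>\<^bsub>BU\<^esub> \<tau> v = \<tau> (u \<otimes>\<^bsub>U\<^esub> v)"
proof -
  have one: "\<one>\<^bsub>A\<^esub> \<in> carrier A" using A_ring by (simp add: ring.ring_simprules)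
  have "\<tau> u \<otimes>\<^bsub>BU\<^esub> \<tau> v = (THE z. \<exists>a\<^sub>1 \<in> carrier A. \<exists>a\<^sub>2 \<in> carrier A. \<exists>u\<^sub>1 \<in> carrier U. \<exists>u\<^sub>2 \<in> carrier U.
        \<tau> u = tensor A M N (\<pi> a\<^sub>1) u\<^sub>1 \<and> \<tau> v = tensor A M N (\<pi> a\<^sub>2) u\<^sub>2 \<and>
        z = \<tau> (\<alpha> a\<^sub>1 \<otimes>\<^bsub>U\<^esub> u\<^sub>1 \<otimes>\<^bsub>U\<^esub> \<alpha> a\<^sub>2 \<otimes>\<^bsub>U\<^esub> u\<^sub>2))"
    by (simp add: bc_algebra_def bc_tensor_def \<tau>_def Let_def)
  also have "\<dots> = \<tau> (u \<otimes>\<^bsub>U\<^esub> v)"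
  proof (rule the_equality)
    show "\<exists>a\<^sub>1 \<in> carrier A. \<exists>a\<^sub>2 \<in> carrier A. \<exists>u\<^sub>1 \<in> carrier U. \<exists>u\<^sub>2 \<in> carrier U.
        \<tau> u = tensor A M N (\<pi> a\<^sub>1) u\<^sub>1 \<and> \<tau> v = tensor A M N (\<pi> a\<^sub>2) u\<^sub>2 \<and>
        \<tau> (u \<otimes>\<^bsub>U\<^esub> v) = \<tau> (\<alpha> a\<^sub>1 \<otimes>\<^bsub>U\<^esub> u\<^sub>1 \<otimes>\<^bsub>U\<^esub> \<alpha> a\<^sub>2 \<otimes>\<^bsub>U\<^esub> u\<^sub>2)"
      by (rule bexI[OF _ one], rule bexI[OF _ one], rule bexI[OF _ uv(1)], rule bexI[OF _ uv(2)])
        (use uv one in \<open>simp add: pure_tensor alpha(4)\<close>)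
  next
    fix z assume "\<exists>a\<^sub>1 \<in> carrier A. \<exists>a\<^sub>2 \<in> carrier A. \<exists>u\<^sub>1 \<in> carrier U. \<exists>u\<^sub>2 \<in> carrier U.
        \<tau> u = tensor A M N (\<pi> a\<^sub>1) u\<^sub>1 \<and> \<tau> v = tensor A M N (\<pi> a\<^sub>2) u\<^sub>2 \<and>
        z = \<tau> (\<alpha> a\<^sub>1 \<otimes>\<^bsub>U\<^esub> u\<^sub>1 \<otimes>\<^bsub>U\<^esub> \<alpha> a\<^sub>2 \<otimes>\<^bsub>U\<^esub> u\<^sub>2)"
    then obtain a b x y where *: "a \<in> carrier A" "b \<in> carrier A" "x \<in> carrier U" "y \<in> carrier U"
      "\<tau> u = \<tau> (\<alpha> a \<otimes>\<^bsub>U\<^esub> x)" "\<tau> v = \<tau> (\<alpha> b \<otimes>\<^bsub>U\<^esub> y)" "z = \<tau> (\<alpha> a \<otimes>\<^bsub>U\<^esub> x \<otimes>\<^bsub>U\<^esub> \<alpha> b \<otimes>\<^bsub>U\<^esub> y)"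
      by (auto simp: pure_tensor)
    have "\<tau> (u \<otimes>\<^bsub>U\<^esub> v) = \<tau> ((\<alpha> a \<otimes>\<^bsub>U\<^esub> x) \<otimes>\<^bsub>U\<^esub> (\<alpha> b \<otimes>\<^bsub>U\<^esub> y))"
      using * uv by (intro tau_mult_cong) (simp_all add: alpha(1))
    then show "z = \<tau> (u \<otimes>\<^bsub>U\<^esub> v)" using * by (simp add: alpha(1) U.m_assoc)
  qed
  finally show ?thesis .
qed

text \<open>A scalar acts on the left factor, and \<open>r 1 \<otimes> u = \<pi>(r 1) \<otimes> u\<close> moves to the right factor as
  \<open>1 \<otimes> \<alpha>(r 1) u\<close>.\<close>

lemma bc_algebra_smult:
  assumes r: "r \<in> carrier R" and u: "u \<in> carrier U"
  shows "r \<odot>\<^bsub>BU\<^esub> \<tau> u = \<tau> (r \<odot>\<^bsub>U\<^esub> u)"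
proof -
  interpret B: poisson_algebra R B by (rule B_poisson)
  have Ba: "assoc_algebra R B" by (rule B.algebra_imp_assoc_algebra)
  have one: "\<one>\<^bsub>A\<^esub> \<in> carrier A" using A_ring by (simp add: ring.ring_simprules)
  have lin: "(\<lambda>b. r \<odot>\<^bsub>B\<^esub> b) \<in> linear_maps A M M"
    using r by (auto simp: linear_maps_def module_via_simps module.smult_closed[OF B.module]
        module.smult_r_distr[OF B.module] assoc_algebra.smult_mult_right[OF Ba] pi(1))
  have "r \<odot>\<^bsub>BU\<^esub> \<tau> u = tensor A M N (r \<odot>\<^bsub>B\<^esub> \<one>\<^bsub>B\<^esub>) u"
    unfolding bc_algebra_simps \<tau>_def
    using u by (intro tensor_factors.tensor_map_left_tensor[OF factors lin]) (simp_all add: module_via_simps B_one)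
  also have "r \<odot>\<^bsub>B\<^esub> \<one>\<^bsub>B\<^esub> = \<pi> (r \<odot>\<^bsub>A\<^esub> \<one>\<^bsub>A\<^esub>)" using pi(4) pi(5)[OF r one] by simp
  also have "tensor A M N \<dots> u = \<tau> (\<alpha> (r \<odot>\<^bsub>A\<^esub> \<one>\<^bsub>A\<^esub>) \<otimes>\<^bsub>U\<^esub> u)"
    using r u one by (intro pure_tensor) (simp_all add: module.smult_closed[OF module])
  also have "\<alpha> (r \<odot>\<^bsub>A\<^esub> \<one>\<^bsub>A\<^esub>) \<otimes>\<^bsub>U\<^esub> u = r \<odot>\<^bsub>U\<^esub> u"
    using r u one by (simp add: alpha(4,5) U.smult_mult_left)
  finally show ?thesis .
qed

lemma tau_alg_hom: "\<tau> \<in> alg_hom R U BU"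
  by (rule alg_homI) (simp_all add: bc_algebra_simps(1-4) bc_algebra_mult bc_algebra_smult tau_closed tau_add)

lemma bc_surj: "\<tau> ` carrier U = carrier BU"
  by (simp add: tau_surj bc_algebra_simps)

lemma tau_zero: "\<tau> \<zero>\<^bsub>U\<^esub> = \<zero>\<^bsub>BU\<^esub>"
  using tau_kernel_zero by (simp add: tau_kernel_def bc_algebra_simps)

lemma bc_assoc_algebra: "assoc_algebra R BU"
  by (rule assoc_algebra_surj_image[OF U.assoc_algebra_axioms tau_alg_hom tau_zero bc_surj])

section \<open>The quotient by the ideal generated by the image of the Poisson ideal\<close>

abbreviation "IB \<equiv> env_ideal A I U \<alpha> \<beta>"
abbreviation "E \<equiv> env_quot A I U \<alpha> \<beta>"

lemma IB_genideal: "IB = Idl\<^bsub>BU\<^esub> ((\<lambda>i. \<tau> (\<beta> i)) ` I)"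
  by (simp add: env_ideal_def bc_algebra_simps)

lemma BU_ring: "ring BU" using bc_assoc_algebra by (simp add: assoc_algebra_def)

lemma generators_carrier: "(\<lambda>i. \<tau> (\<beta> i)) ` I \<subseteq> carrier BU"
  by (auto simp: bc_algebra_simps beta(1) I_A tau_closed)

lemma IB_ideal: "ideal IB BU"
  unfolding IB_genideal by (rule ring.genideal_ideal[OF BU_ring generators_carrier])

definition proj :: "'u \<Rightarrow> ('a set \<times> 'u \<Rightarrow>\<^sub>0 int) set set"
  where "proj u = IB +>\<^bsub>BU\<^esub> \<tau> u"

lemma proj_alg_hom: "proj \<in> alg_hom R U E"
  unfolding proj_def env_quot_def
  by (rule alg_hom_comp[OF tau_alg_hom coset_alg_hom[OF bc_assoc_algebra IB_ideal]])

lemma proj_surj: "proj ` carrier U = carrier E"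
proof -
  have "proj ` carrier U = (\<lambda>x. IB +>\<^bsub>BU\<^esub> x) ` (\<tau> ` carrier U)" by (simp add: proj_def image_image)
  also have "\<dots> = carrier E"
    unfolding bc_surj env_quot_def by (rule coset_surj)
  finally show ?thesis .
qed

lemma E_assoc_algebra: "assoc_algebra R E"
  unfolding env_quot_def by (rule assoc_algebra_alg_quot[OF bc_assoc_algebra IB_ideal])

lemma proj_eq_zero_iff: "u \<in> carrier U \<Longrightarrow> proj u = \<zero>\<^bsub>E\<^esub> \<longleftrightarrow> \<tau> u \<in> IB"
  using ideal.coset_eq_zero_iff[OF IB_ideal, of "\<tau> u"]
  by (simp add: proj_def env_quot_def alg_quot_simps quot_zero bc_algebra_simps tau_closed)

lemma proj_alpha_ideal: "i \<in> I \<Longrightarrow> proj (\<alpha> i) = \<zero>\<^bsub>E\<^esub>"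
  using tau_alpha_ideal[of i "\<one>\<^bsub>U\<^esub>"] additive_subgroup.zero_closed[OF ideal.axioms(1)[OF IB_ideal]]
  by (simp add: proj_eq_zero_iff alpha(1) I_A bc_algebra_simps)

lemma proj_beta_ideal: "i \<in> I \<Longrightarrow> proj (\<beta> i) = \<zero>\<^bsub>E\<^esub>"
  using ring.genideal_self[OF BU_ring generators_carrier]
  by (auto simp: proj_eq_zero_iff beta(1) I_A IB_genideal)

text \<open>The maps \<open>\<alpha>\<close> and \<open>\<beta>\<close> of the quotient are well defined, with the expected values, because \<open>proj\<close>
  kills \<open>\<alpha>(I)\<close> and \<open>\<beta>(I)\<close>.\<close>

lemma env_map_coset:
  assumes closed: "\<And>a. a \<in> carrier A \<Longrightarrow> \<theta> a \<in> carrier U"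
    and add: "\<And>a b. \<lbrakk>a \<in> carrier A; b \<in> carrier A\<rbrakk> \<Longrightarrow> \<theta> (a \<oplus>\<^bsub>A\<^esub> b) = \<theta> a \<oplus>\<^bsub>U\<^esub> \<theta> b"
    and kills: "\<And>i. i \<in> I \<Longrightarrow> proj (\<theta> i) = \<zero>\<^bsub>E\<^esub>" and a: "a \<in> carrier A"
  shows "env_map A I U \<alpha> \<beta> \<theta> (\<pi> a) = proj (\<theta> a)"
proof -
  interpret E: assoc_algebra R E by (rule E_assoc_algebra)
  have "proj (\<theta> x) = proj (\<theta> a)" if x: "x \<in> \<pi> a" for x
  proof -
    obtain i where i: "i \<in> I" "x = i \<oplus>\<^bsub>A\<^esub> a" using x by (auto simp: a_r_coset_def')
    then show ?thesis
      using a by (simp add: add closed I_A alg_homD(1,2)[OF proj_alg_hom] kills)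
  qed
  moreover have "a \<in> \<pi> a" using a by (simp add: mem_coset_iff)
  ultimately have "(\<lambda>x. proj (\<theta> x)) ` \<pi> a = {proj (\<theta> a)}" by blast
  then show ?thesis by (simp add: env_map_def bc_algebra_simps(6) flip: proj_def)
qed

text \<open>The kernel of \<open>proj\<close> is the smallest two-sided ideal containing \<open>\<alpha>(I)\<close> and \<open>\<beta>(I)\<close>: a morphism
  \<open>g\<close> that kills \<open>\<alpha>(I)\<close> factors through \<open>\<tau>\<close>, and if it also kills \<open>\<beta>(I)\<close>, the kernel of the factor is
  an ideal containing the generators of \<open>IB\<close>.\<close>

lemma proj_kernel_minimal:
  assumes V: "assoc_algebra R V" and g: "g \<in> alg_hom R U V"
    and kills: "\<And>i. i \<in> I \<Longrightarrow> g (\<alpha> i) = \<zero>\<^bsub>V\<^esub>" "\<And>i. i \<in> I \<Longrightarrow> g (\<beta> i) = \<zero>\<^bsub>V\<^esub>"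
    and u: "u \<in> carrier U" "proj u = \<zero>\<^bsub>E\<^esub>"
  shows "g u = \<zero>\<^bsub>V\<^esub>"
proof -
  interpret V: assoc_algebra R V by (rule V)
  have ker: "g v = \<zero>\<^bsub>V\<^esub>" if "v \<in> carrier U" "\<tau> v = \<zero>\<^bsub>BU\<^esub>" for v
    using additive_kills_tau_kernel[OF V.a_comm_group, of g v] that
    by (simp add: alg_homD[OF g] kills alpha(1) I_A bc_algebra_simps)
  obtain h where h: "h \<in> alg_hom R BU V" "\<And>v. v \<in> carrier U \<Longrightarrow> h (\<tau> v) = g v"
    using alg_hom_factor[OF U.ring_axioms BU_ring V.ring_axioms tau_alg_hom bc_surj g U.smult_closed ker]
    by metis
  interpret h: ring_hom_ring BU V h
    by (rule alg_hom_ring_hom_ring[OF h(1) BU_ring V.ring_axioms])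
  have "IB \<subseteq> a_kernel BU V h"
    unfolding IB_genideal
  proof (rule ring.genideal_minimal[OF BU_ring h.kernel_is_ideal], rule image_subsetI)
    fix i assume i: "i \<in> I"
    then have c: "\<beta> i \<in> carrier U" by (simp add: beta(1) I_A)
    have "h (\<tau> (\<beta> i)) = \<zero>\<^bsub>V\<^esub>" using h(2)[OF c] kills(2)[OF i] by simp
    then show "\<tau> (\<beta> i) \<in> a_kernel BU V h"
      unfolding a_kernel_def' using alg_homD(1)[OF tau_alg_hom c] by blast
  qed
  then have "\<tau> u \<in> a_kernel BU V h" using u proj_eq_zero_iff[OF u(1)] by blast
  then have "h (\<tau> u) = \<zero>\<^bsub>V\<^esub>" unfolding a_kernel_def' by blast
  then show ?thesis using h(2)[OF u(1)] by simp
qed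

lemma enveloping_quotient:
  assumes "poisson_enveloping TYPE('d) R A U \<alpha> \<beta>"
  shows "poisson_enveloping TYPE('d) R B E (env_map A I U \<alpha> \<beta> \<alpha>) (env_map A I U \<alpha> \<beta> \<beta>)"
proof (rule poisson_enveloping_quotient[OF assms B_poisson coset_poisson_hom coset_poisson_surj
      E_assoc_algebra proj_alg_hom proj_surj])
  show "env_map A I U \<alpha> \<beta> \<alpha> (\<pi> a) = proj (\<alpha> a)" if "a \<in> carrier A" for a
    using that by (intro env_map_coset) (simp_all add: alpha proj_alpha_ideal)
  show "env_map A I U \<alpha> \<beta> \<beta> (\<pi> a) = proj (\<beta> a)" if "a \<in> carrier A" for a
    using that by (intro env_map_coset) (simp_all add: beta proj_beta_ideal)
next
  fix V :: "('r, 'd) module" and g u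
  assume *: "assoc_algebra R V" "g \<in> alg_hom R U V"
    "\<And>a. \<lbrakk>a \<in> carrier A; \<pi> a = \<zero>\<^bsub>B\<^esub>\<rbrakk> \<Longrightarrow> g (\<alpha> a) = \<zero>\<^bsub>V\<^esub> \<and> g (\<beta> a) = \<zero>\<^bsub>V\<^esub>"
    "u \<in> carrier U" "proj u = \<zero>\<^bsub>E\<^esub>"
  show "g u = \<zero>\<^bsub>V\<^esub>"
    by (rule proj_kernel_minimal[OF *(1,2) _ _ *(4,5)]) (use *(3) I_A pi_zero_iff in auto)
qed

end

theorem theorem2p19:
  fixes R :: "'r ring" and A :: "('r, 'a) poisson" and I :: "'a set"
    and U :: "('r, 'u) module" and \<alpha>\<^sub>A \<beta>\<^sub>A :: "'a \<Rightarrow> 'u"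
  assumes "cring R"
    and "poisson_algebra R A"
    and "poisson_ideal R A I"
    and "poisson_enveloping TYPE('u) R A U \<alpha>\<^sub>A \<beta>\<^sub>A"
    and "poisson_enveloping TYPE('d) R A U \<alpha>\<^sub>A \<beta>\<^sub>A"
  shows "poisson_enveloping TYPE('d) R (poisson_quot A I)
    (env_quot A I U \<alpha>\<^sub>A \<beta>\<^sub>A)
    (env_map A I U \<alpha>\<^sub>A \<beta>\<^sub>A \<alpha>\<^sub>A) (env_map A I U \<alpha>\<^sub>A \<beta>\<^sub>A \<beta>\<^sub>A)"
proof -
  have "poisson_pair R A U \<alpha>\<^sub>A \<beta>\<^sub>A" using assms(4) by (simp add: poisson_enveloping_def)
  then have "poisson_base_change R A I U \<alpha>\<^sub>A \<beta>\<^sub>A"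
    using assms(3) poisson_enveloping_generated[OF assms(4)]
    by (simp add: poisson_base_change_def poisson_base_change_axioms_def)
  then show ?thesis by (rule poisson_base_change.enveloping_quotient[OF _ assms(5)])
qed

end
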